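(* Let $\mathscr{A}$ be a $W^*$-algebra, let $\mathscr{X}$ be a self-dual Hilbert $\mathscr{A}$-module and let $\mathscr{Y}$ be an orthogonally complemented submodule of $\mathscr{X}$. Let $B:\mathscr{X}\times\mathscr{X}\to\mathscr{A}$ be a bounded $\mathscr{A}$-valued inner product on $\mathscr{X}$. Assume there exist $c>0$ and $k>0$ such that for every pure state $f$ of $\mathscr{A}$ and every $x\in\mathscr{Y}$ there exists a unit vector $y\in\mathscr{Y}$ such that $f(|y|^2)\ge k$ and $$|f(B(x,y))|^2\ge c\,f(|x|^2)\,f(|y|^2).$$ Then $\mathscr{Y}$ is an orthogonally complemented submodule of $\mathscr{X}$ with respect to the inner product $B$, i.e. $\mathscr{X}=\mathscr{Y}\oplus\{s\in\mathscr{X}:B(s,y)=0\text{ for all }y\in\mathscr{Y}\}$.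
   Context: Hilbert $C^*$-modules are right modules with inner product $\langle\cdot,\cdot\rangle$ conjugate-linear in the first and $\mathscr{A}$-linear in the second variable; $|x|^2=\langle x,x\rangle$ and $\|x\|=\|\langle x,x\rangle\|^{1/2}$ refer to the original inner product. $\mathscr{X}$ is self-dual if every bounded $\mathscr{A}$-linear map $\mathscr{X}\to\mathscr{A}$ has the form $y\mapsto\langle x,y\rangle$ for some $x\in\mathscr{X}$. A closed submodule $\mathscr{Y}$ is orthogonally complemented if $\mathscr{X}=\mathscr{Y}\oplus\mathscr{Y}^\perp$. "Bounded $\mathscr{A}$-valued inner product" means an $\mathscr{A}$-valued inner product $B$ (with the same linearity conventions) with $\|B(x,y)\|\le M\|x\|\|y\|$ for some constant $M$. *)

theory Defs
  imports "HOL-Analysis.Analysis"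
begin

section \<open>C*-algebras and W*-algebras\<close>

class complex_vector = real_vector +
  fixes scaleC :: "complex \<Rightarrow> 'a \<Rightarrow> 'a"  (infixr "*\<^sub>C" 75)
  assumes scaleC_of_real: "scaleC (complex_of_real r) x = scaleR r x"
    and scaleC_add_right: "scaleC c (x + y) = scaleC c x + scaleC c y"
    and scaleC_add_left: "scaleC (c + d) x = scaleC c x + scaleC d x"
    and scaleC_scaleC: "scaleC c (scaleC d x) = scaleC (c * d) x"

text \<open>
  Unital C*-algebras. The sort \<open>monoid_mult\<close> is used instead of
  \<open>real_normed_algebra_1\<close> because the latter requires \<open>0 \<noteq> 1\<close> and so would exclude
  the zero algebra.
\<close>

class cstar_algebra = real_normed_algebra + monoid_mult + banach + complex_vector +
  fixes star :: "'a \<Rightarrow> 'a"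
  assumes scaleC_mult_left: "scaleC c a * b = scaleC c (a * b)"
    and scaleC_mult_right: "a * scaleC c b = scaleC c (a * b)"
    and norm_scaleC: "norm (scaleC c a) = cmod c * norm a"
    and star_add: "star (a + b) = star a + star b"
    and star_scaleC: "star (scaleC c a) = scaleC (cnj c) (star a)"
    and star_mult: "star (a * b) = star b * star a"
    and star_star: "star (star a) = a"
    and norm_star_mult: "norm (star a * a) = (norm a)\<^sup>2"

text \<open>
  The type of bounded linear functionals into \<open>complex\<close> only provides real linearity;
  the dual space consists of the complex linear ones among them.
\<close>

definition complex_dual :: "('a::{real_normed_vector, complex_vector} \<Rightarrow>\<^sub>L complex) set" where
  "complex_dual = {\<phi>. \<forall>c a. blinfun_apply \<phi> (c *\<^sub>C a) = c * blinfun_apply \<phi> a}"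

text \<open>
  A Banach space \<open>E\<close> together with an isometric isomorphism from \<open>A\<close> onto the dual of \<open>E\<close>
  is encoded by the canonical image \<open>P\<close> of \<open>E\<close> in the dual of \<open>A\<close>: a closed complex subspace
  such that evaluation \<open>a \<mapsto> (\<phi> \<mapsto> \<phi> a)\<close> is an isometry (second conjunct) from \<open>A\<close> onto
  the space of bounded complex linear functionals on \<open>P\<close> (third conjunct).
\<close>

definition is_predual :: "('a::{real_normed_vector, complex_vector} \<Rightarrow>\<^sub>L complex) set \<Rightarrow> bool" where
  "is_predual P \<longleftrightarrow>
     (P \<subseteq> complex_dual \<and> closed P \<and> subspace P \<and>
       (\<forall>c. \<forall>\<phi>\<in>P. blinfun_mult_right c o\<^sub>L \<phi> \<in> P)) \<and>
     (\<forall>a. norm a = (SUP \<phi>\<in>{\<phi> \<in> P. norm \<phi> \<le> 1}. cmod (blinfun_apply \<phi> a))) \<and>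
     (\<forall>F :: ('a \<Rightarrow>\<^sub>L complex) \<Rightarrow> complex.
        (\<forall>\<phi>\<in>P. \<forall>\<psi>\<in>P. F (\<phi> + \<psi>) = F \<phi> + F \<psi>) \<and>
        (\<forall>c. \<forall>\<phi>\<in>P. F (blinfun_mult_right c o\<^sub>L \<phi>) = c * F \<phi>) \<and>
        (\<exists>K. \<forall>\<phi>\<in>P. cmod (F \<phi>) \<le> K * norm \<phi>) \<longrightarrow>
        (\<exists>a. \<forall>\<phi>\<in>P. F \<phi> = blinfun_apply \<phi> a))"

text \<open>
  W*-algebras in the sense of Sakai: C*-algebras that are dual Banach spaces. Such an algebra
  always has a unit, so working with unital C*-algebras is no restriction.
\<close>

definition wstar_algebra :: "'a::cstar_algebra itself \<Rightarrow> bool" where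
  "wstar_algebra _ \<longleftrightarrow> (\<exists>P :: ('a \<Rightarrow>\<^sub>L complex) set. is_predual P)"

section \<open>Positivity and pure states\<close>

definition spectrum :: "'a::cstar_algebra \<Rightarrow> complex set" where
  "spectrum a = {z. \<not> (\<exists>b. b * (z *\<^sub>C 1 - a) = 1 \<and> (z *\<^sub>C 1 - a) * b = 1)}"

definition positive :: "'a::cstar_algebra \<Rightarrow> bool" where
  "positive a \<longleftrightarrow> star a = a \<and> spectrum a \<subseteq> \<real>\<^sub>\<ge>\<^sub>0"

definition states :: "('a::cstar_algebra \<Rightarrow>\<^sub>L complex) set" where
  "states = {f \<in> complex_dual.
     (\<forall>a. positive a \<longrightarrow> blinfun_apply f a \<in> \<real>\<^sub>\<ge>\<^sub>0) \<and> blinfun_apply f 1 = 1}"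

definition pure_states :: "('a::cstar_algebra \<Rightarrow>\<^sub>L complex) set" where
  "pure_states = {f. f extreme_point_of states}"

section \<open>Hilbert C*-modules\<close>

locale cstar_right_module =
  fixes act :: "'x::complex_vector \<Rightarrow> 'a::cstar_algebra \<Rightarrow> 'x"
  assumes act_add_left: "act (x + y) a = act x a + act y a"
    and act_add_right: "act x (a + b) = act x a + act x b"
    and act_act: "act (act x a) b = act x (a * b)"
    and act_one: "act x 1 = x"
    and act_scaleC_left: "act (c *\<^sub>C x) a = c *\<^sub>C act x a"
    and act_scaleC_right: "act x (c *\<^sub>C a) = c *\<^sub>C act x a"

text \<open>Conjugate linearity in the first variable follows from \<open>star_ip\<close>.\<close>

locale cstar_inner_product = cstar_right_module act
  for act :: "'x::complex_vector \<Rightarrow> 'a::cstar_algebra \<Rightarrow> 'x" +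
  fixes ip :: "'x \<Rightarrow> 'x \<Rightarrow> 'a"
  assumes ip_add_right: "ip x (y + z) = ip x y + ip x z"
    and ip_scaleC_right: "ip x (c *\<^sub>C y) = c *\<^sub>C ip x y"
    and ip_act_right: "ip x (act y a) = ip x y * a"
    and star_ip: "star (ip x y) = ip y x"
    and ip_positive: "positive (ip x x)"
    and ip_definite: "ip x x = 0 \<Longrightarrow> x = 0"

text \<open>Completeness is part of the sort \<open>banach\<close>.\<close>

locale hilbert_cstar_module = cstar_inner_product act ip
  for act :: "'x::{banach, complex_vector} \<Rightarrow> 'a::cstar_algebra \<Rightarrow> 'x"
    and ip :: "'x \<Rightarrow> 'x \<Rightarrow> 'a" +
  assumes norm_ip: "norm x = sqrt (norm (ip x x))"

definition self_dual ::
  "('x::real_normed_vector \<Rightarrow> 'a::cstar_algebra \<Rightarrow> 'x) \<Rightarrow> ('x \<Rightarrow> 'x \<Rightarrow> 'a) \<Rightarrow> bool" where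
  "self_dual act ip \<longleftrightarrow>
     (\<forall>\<phi> :: 'x \<Rightarrow> 'a. bounded_linear \<phi> \<and> (\<forall>y a. \<phi> (act y a) = \<phi> y * a) \<longrightarrow>
        (\<exists>x. \<forall>y. \<phi> y = ip x y))"

definition bounded_form :: "('x::real_normed_vector \<Rightarrow> 'x \<Rightarrow> 'a::real_normed_vector) \<Rightarrow> bool" where
  "bounded_form B \<longleftrightarrow> (\<exists>M. \<forall>x y. norm (B x y) \<le> M * norm x * norm y)"

text \<open>Closedness under complex scalars follows, since \<open>c *\<^sub>C y = act y (c *\<^sub>C 1)\<close>.\<close>

definition submodule :: "('x::real_vector \<Rightarrow> 'a \<Rightarrow> 'x) \<Rightarrow> 'x set \<Rightarrow> bool" where
  "submodule act Y \<longleftrightarrow> subspace Y \<and> (\<forall>y\<in>Y. \<forall>a. act y a \<in> Y)"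

definition orthogonal_complement :: "('x \<Rightarrow> 'x \<Rightarrow> 'a::zero) \<Rightarrow> 'x set \<Rightarrow> 'x set" where
  "orthogonal_complement B Y = {s. \<forall>y\<in>Y. B s y = 0}"

definition orthogonally_complemented ::
  "('x::real_vector \<Rightarrow> 'a::zero \<Rightarrow> 'x) \<Rightarrow> ('x \<Rightarrow> 'x \<Rightarrow> 'a) \<Rightarrow> 'x set \<Rightarrow> bool" where
  "orthogonally_complemented act B Y \<longleftrightarrow>
     submodule act Y \<and>
     (\<forall>x. \<exists>y\<in>Y. \<exists>s\<in>orthogonal_complement B Y. x = y + s) \<and>
     Y \<inter> orthogonal_complement B Y = {0}"

end

theory Submission
  imports Defs
begin

text \<open>
  Self-duality followed by the projection onto \<open>Y\<close> gives \<open>G\<close> with values in \<open>Y\<close>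
  such that \<open>B x y\<close> is the original inner product of \<open>G x\<close> and \<open>y\<close> for \<open>y\<close> in \<open>Y\<close>;
  then \<open>x - y\<close> is \<open>B\<close>-orthogonal to \<open>Y\<close> iff \<open>G y = G x\<close>, so it suffices that \<open>G\<close> maps \<open>Y\<close>
  onto \<open>Y\<close>. On \<open>Y\<close> the operator \<open>G\<close> is selfadjoint, hence
  \<open>|(G - \<i>t) x|\<^sup>2 = |G x|\<^sup>2 + t\<^sup>2 |x|\<^sup>2\<close>. For a pure state \<open>f\<close> that attains the norm of \<open>|x|\<^sup>2\<close>,
  the hypothesis and the Cauchy-Schwarz inequality give \<open>f (|G x|\<^sup>2) \<ge> c f (|x|\<^sup>2) = c \<parallel>x\<parallel>\<^sup>2\<close>.
  So \<open>G - \<i>t\<close> is bounded below by \<open>\<surd>c\<close> for every real \<open>t\<close>; it is onto for large \<open>t\<close>,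
  and this persists down to \<open>t = 0\<close>.
\<close>

section \<open>Scalars, involution and spectrum\<close>

lemma scaleC_one [simp]: "1 *\<^sub>C (x::'a::complex_vector) = x"
  using scaleC_of_real[of 1 x] by simp

lemma scaleC_zero_left [simp]: "0 *\<^sub>C (x::'a::complex_vector) = 0"
  using scaleC_of_real[of 0 x] by simp

lemma scaleC_zero_right [simp]: "c *\<^sub>C (0::'a::complex_vector) = 0"
  using scaleC_add_right[of c 0 "0::'a"] by simp

lemma scaleC_minus_left: "(- c) *\<^sub>C (x::'a::complex_vector) = - (c *\<^sub>C x)"
  using scaleC_add_left[of c "- c" x] by (simp add: eq_neg_iff_add_eq_0 add.commute)

lemma scaleC_minus_right: "c *\<^sub>C (- x::'a::complex_vector) = - (c *\<^sub>C x)"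
  using scaleC_add_right[of c x "- x"] by (simp add: eq_neg_iff_add_eq_0 add.commute)

lemma scaleC_diff_left: "(c - d) *\<^sub>C (x::'a::complex_vector) = c *\<^sub>C x - d *\<^sub>C x"
  using scaleC_add_left[of c "- d" x] by (simp add: scaleC_minus_left)

lemma scaleC_diff_right: "c *\<^sub>C (x - y::'a::complex_vector) = c *\<^sub>C x - c *\<^sub>C y"
  using scaleC_add_right[of c x "- y"] by (simp add: scaleC_minus_right)

lemma scaleC_sum_left: "(\<Sum>i\<in>I. c i) *\<^sub>C (x::'a::complex_vector) = (\<Sum>i\<in>I. c i *\<^sub>C x)"
  by (induction I rule: infinite_finite_induct) (simp_all add: scaleC_add_left)

lemmas scaleC_simps = scaleC_add_left scaleC_add_right scaleC_diff_left scaleC_diff_right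
  scaleC_minus_left scaleC_minus_right scaleC_scaleC

section \<open>The involution and the norm\<close>

lemma star_one [simp]: "star (1::'a::cstar_algebra) = 1"
  by (metis mult_1_right star_mult star_star)

lemma star_minus: "star (- a::'a::cstar_algebra) = - star a"
  using star_scaleC[of "-1" a] by (simp add: scaleC_minus_left)

lemma star_diff: "star (a - b::'a::cstar_algebra) = star a - star b"
  using star_add[of a "- b"] by (simp add: star_minus)

lemma star_scaleR: "star (r *\<^sub>R a::'a::cstar_algebra) = r *\<^sub>R star a"
  using star_scaleC[of "complex_of_real r" a] by (simp add: scaleC_of_real)

lemma star_power: "star (a ^ n::'a::cstar_algebra) = star a ^ n"
  by (induction n) (simp_all add: star_mult power_commutes)

text \<open>The C*-identity at 1 makes the norm of 1 equal to its square. The value 0 has to be kept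
  because the class admits the zero algebra.\<close>

lemma norm_one_cases: "norm (1::'a::cstar_algebra) = 0 \<or> norm (1::'a) = 1"
  using norm_star_mult[of "1::'a"] by (simp add: power2_eq_square)

lemma norm_one_le: "norm (1::'a::cstar_algebra) \<le> 1"
  using norm_one_cases[where 'a='a] by auto

lemma norm_one_eq:
  assumes "(a::'a::cstar_algebra) \<noteq> 0"
  shows "norm (1::'a) = 1"
  by (metis assms mult_1_left mult_zero_left norm_eq_zero norm_one_cases)

lemma norm_star [simp]: "norm (star a::'a::cstar_algebra) = norm a"
proof -
  have le: "norm b \<le> norm (star b)" for b :: 'a
  proof (cases "b = 0")
    case False
    have "norm b * norm b \<le> norm (star b) * norm b"
      using norm_mult_ineq[of "star b" b] by (simp add: norm_star_mult power2_eq_square)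
    then show ?thesis using False by simp
  qed simp
  show ?thesis using le[of a] le[of "star a"] by (simp add: star_star)
qed

lemma norm_power_le_one:
  assumes "norm (a::'a::cstar_algebra) \<le> 1"
  shows "norm (a ^ n) \<le> 1"
proof (induction n)
  case (Suc n)
  then show ?case
    using norm_mult_ineq[of a "a ^ n"] mult_mono[OF assms Suc] by simp
qed (simp add: norm_one_le)

text \<open>Each squaring is one use of the C*-identity, hence the exponents that are powers of two.
  They suffice to contradict a decay of all large powers of an element of norm 1.\<close>

lemma norm_selfadjoint_power:
  assumes "star a = (a::'a::cstar_algebra)"
  shows "norm (a ^ 2 ^ k) = norm a ^ 2 ^ k"
proof (induction k)
  case (Suc k)
  have "norm (a ^ 2 ^ Suc k) = norm (star (a ^ 2 ^ k) * a ^ 2 ^ k)"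
    by (simp add: star_power assms power_add[symmetric] mult_2)
  also have "\<dots> = norm a ^ 2 ^ Suc k"
    by (simp add: norm_star_mult Suc power_mult[symmetric] mult.commute)
  finally show ?case .
qed simp

text \<open>A right and a left inverse are the fixed points of the contractions b -> 1 + a b and b
  -> 1 + b a, which replaces the summation of the geometric series. By associativity the two
  coincide.\<close>

lemma neumann_inverse:
  assumes "norm (a::'a::cstar_algebra) < 1"
  shows "\<exists>b. b * (1 - a) = 1 \<and> (1 - a) * b = 1"
proof -
  have 1: "\<exists>!b. 1 + a * b = b"
  proof (rule banach_fix_type[where c="norm a"])
    show "\<forall>x y. dist (1 + a * x) (1 + a * y) \<le> norm a * dist x y"
      by (metis dist_norm add_diff_cancel_left norm_mult_ineq right_diff_distrib)
  qed (use assms in auto)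
  have 2: "\<exists>!b. 1 + b * a = b"
  proof (rule banach_fix_type[where c="norm a"])
    show "\<forall>x y. dist (1 + x * a) (1 + y * a) \<le> norm a * dist x y"
      by (metis dist_norm add_diff_cancel_left norm_mult_ineq left_diff_distrib mult.commute)
  qed (use assms in auto)
  obtain b d where "1 + a * b = b" "1 + d * a = d" using 1 2 by blast
  then have bd: "(1 - a) * b = 1" "d * (1 - a) = 1"
    by (simp_all add: algebra_simps eq_diff_eq)
  have "d = d * ((1 - a) * b)" using bd by simp
  also have "\<dots> = b" by (simp add: mult.assoc[symmetric] bd(2))
  finally show ?thesis using bd by blast
qed

section \<open>Elementary spectral theory\<close>

lemma not_in_spectrumI:
  assumes "b * (z *\<^sub>C 1 - a) = 1" "(z *\<^sub>C 1 - a) * b = (1::'a::cstar_algebra)"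
  shows "z \<notin> spectrum a"
  using assms unfolding spectrum_def by blast

lemma spectrum_norm_le:
  assumes "z \<in> spectrum (a::'a::cstar_algebra)"
  shows "cmod z \<le> norm a"
proof (rule ccontr)
  assume "\<not> ?thesis"
  then have z: "norm a < cmod z" "z \<noteq> 0" by auto
  then have "norm (inverse z *\<^sub>C a) < 1"
    using mult_strict_left_mono[OF z(1), of "cmod (inverse z)"]
    by (simp add: norm_scaleC norm_mult[symmetric])
  then obtain b where b: "b * (1 - inverse z *\<^sub>C a) = 1" "(1 - inverse z *\<^sub>C a) * b = 1"
    using neumann_inverse by blast
  have e: "z *\<^sub>C 1 - a = z *\<^sub>C (1 - inverse z *\<^sub>C a)"
    using z by (simp add: scaleC_simps)
  have "z \<notin> spectrum a"
    by (rule not_in_spectrumI[of "inverse z *\<^sub>C b"])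
      (use b z in \<open>simp_all add: e scaleC_mult_left scaleC_mult_right scaleC_scaleC\<close>)
  with assms show False by blast
qed

lemma spectrum_affine_imp:
  assumes "z \<in> spectrum (a::'a::cstar_algebra)" "w \<noteq> 0"
  shows "u + w * z \<in> spectrum (u *\<^sub>C 1 + w *\<^sub>C a)"
proof (rule ccontr)
  assume "\<not> ?thesis"
  then obtain b where b: "b * ((u + w * z) *\<^sub>C 1 - (u *\<^sub>C 1 + w *\<^sub>C a)) = 1"
    "((u + w * z) *\<^sub>C 1 - (u *\<^sub>C 1 + w *\<^sub>C a)) * b = 1"
    unfolding spectrum_def by blast
  have e: "(u + w * z) *\<^sub>C 1 - (u *\<^sub>C 1 + w *\<^sub>C a) = w *\<^sub>C (z *\<^sub>C 1 - a)"
    by (simp add: scaleC_simps)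
  have "z \<notin> spectrum a"
    by (rule not_in_spectrumI[of "w *\<^sub>C b"])
      (use b in \<open>simp_all add: e scaleC_mult_left scaleC_mult_right\<close>)
  with assms show False by blast
qed

lemma spectrum_affine:
  assumes "w \<noteq> 0"
  shows "spectrum (u *\<^sub>C 1 + w *\<^sub>C (a::'a::cstar_algebra)) = (\<lambda>z. u + w * z) ` spectrum a"
proof (intro set_eqI iffI)
  fix z assume "z \<in> spectrum (u *\<^sub>C 1 + w *\<^sub>C a)"
  \<comment> \<open>This inclusion is \<open>spectrum_affine_imp\<close> for the inverse affine map,
    with coefficients \<open>- u / w\<close> and \<open>inverse w\<close>.\<close>
  from spectrum_affine_imp[OF this, of "inverse w" "- u / w"] assms
  have "(z - u) / w \<in> spectrum ((- u / w) *\<^sub>C 1 + inverse w *\<^sub>C (u *\<^sub>C 1 + w *\<^sub>C a))"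
    by (simp add: field_simps)
  also have "(- u / w) *\<^sub>C 1 + inverse w *\<^sub>C (u *\<^sub>C 1 + w *\<^sub>C a) = a"
    using assms by (simp add: scaleC_simps divide_inverse mult.commute)
  finally show "z \<in> (\<lambda>z. u + w * z) ` spectrum a"
    using assms by (intro image_eqI[where x="(z - u) / w"]) simp_all
qed (use assms spectrum_affine_imp in blast)

text \<open>Arens' trick: after removing the real part, shift by i s. The spectral point i (s + Im
  z) is bounded by the norm of b + i s, whose square is at most s^2 +
  \<open>(norm b)\<^sup>2\<close>. The terms s^2 cancel, and what remains is linear in s, so it
  cannot stay bounded unless Im z = 0.\<close>

lemma spectrum_selfadjoint_real:
  assumes "star a = (a::'a::cstar_algebra)" "z \<in> spectrum a"
  shows "z \<in> \<real>"
proof (rule ccontr)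
  assume "z \<notin> \<real>"
  then have im: "Im z \<noteq> 0" by (simp add: complex_is_Real_iff)
  define b where "b = complex_of_real (- Re z) *\<^sub>C 1 + 1 *\<^sub>C a"
  have sb: "star b = b" by (simp add: b_def star_add star_scaleC assms)
  have "\<i> * Im z \<in> spectrum b"
  proof -
    have "complex_of_real (- Re z) + 1 * z \<in> spectrum b"
      unfolding b_def by (rule spectrum_affine_imp[OF assms(2)]) simp
    also have "complex_of_real (- Re z) + 1 * z = \<i> * Im z" by (simp add: complex_eq_iff)
    finally show ?thesis .
  qed
  then have sh: "\<i> * s + 1 * (\<i> * Im z) \<in> spectrum ((\<i> * s) *\<^sub>C 1 + 1 *\<^sub>C b)" for s :: real
    by (rule spectrum_affine_imp) simp
  have ineq: "(Im z)\<^sup>2 + 2 * Im z * s \<le> (norm b)\<^sup>2" for s :: real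
  proof -
    let ?d = "(\<i> * s) *\<^sub>C 1 + b"
    have "cmod (\<i> * s + \<i> * Im z) \<le> norm ?d"
      using spectrum_norm_le[OF sh[of s]] by simp
    then have "(cmod (\<i> * s + \<i> * Im z))\<^sup>2 \<le> (norm ?d)\<^sup>2"
      by (intro power_mono) auto
    also have "(norm ?d)\<^sup>2 = norm (star ?d * ?d)" by (simp add: norm_star_mult)
    also have "star ?d * ?d = (s\<^sup>2) *\<^sub>R 1 + star b * b"
      by (simp add: star_add star_scaleC sb algebra_simps scaleC_mult_left scaleC_mult_right
          scaleC_simps power2_eq_square scaleC_of_real[symmetric])
    also have "norm \<dots> \<le> s\<^sup>2 + (norm b)\<^sup>2"
      by (rule order.trans[OF norm_triangle_ineq])
        (simp add: norm_star_mult mult_left_le norm_one_le)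
    also have "(cmod (\<i> * s + \<i> * Im z))\<^sup>2 = (s + Im z)\<^sup>2"
      by (simp add: cmod_power2)
    finally show ?thesis by (simp add: power2_eq_square algebra_simps)
  qed
  \<comment> \<open>For this s the linear term alone equals the right-hand side, so nothing is left
    for \<open>(Im z)\<^sup>2\<close>.\<close>
  have "2 * Im z * ((norm b)\<^sup>2 / (2 * Im z)) = (norm b)\<^sup>2" using im by simp
  with ineq[of "(norm b)\<^sup>2 / (2 * Im z)"] have "(Im z)\<^sup>2 \<le> 0" by linarith
  with im show False by simp
qed

section \<open>The spectral radius of a selfadjoint element\<close>

text \<open>A geometric sum whose ratio w is an n-th root of unity, different from 1 because n does
  not divide k for 0 < k < n. It filters the constant term out of a polynomial averaged over the
  roots of unity.\<close>

lemma sum_root_of_unity_powers: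
  assumes "k < n"
  shows "(\<Sum>j<n. cis (2 * pi * real j / real n) ^ k) = (if k = 0 then of_nat n else 0)"
proof (cases "k = 0")
  case False
  define w where "w = cis (2 * pi * real k / real n)"
  have "(\<Sum>j<n. cis (2 * pi * real j / real n) ^ k) = (\<Sum>j<n. w ^ j)"
    by (intro sum.cong refl) (simp add: w_def Complex.DeMoivre mult_ac)
  moreover have "w ^ n = 1"
  proof -
    have "w ^ n = cis (2 * pi * real k)" using assms by (simp add: w_def Complex.DeMoivre)
    also have "\<dots> = 1" using cis_multiple_2pi[of "real k"] by simp
    finally show ?thesis .
  qed
  moreover have "w \<noteq> 1"
  proof
    assume "w = 1"
    then have "cos (2 * pi * real k / real n) = 1"
      by (simp add: w_def complex_eq_iff)
    then obtain m :: int where "2 * pi * real k / real n = of_int m * 2 * pi"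
      unfolding cos_one_2pi_int by blast
    then have "(2 * pi) * (real k / real n) = (2 * pi) * of_int m" by simp
    then have "real k / real n = of_int m" by (metis mult_left_cancel pi_neq_zero mult_eq_0_iff zero_neq_numeral)
    then have "real k = of_int m * real n" using assms by (simp add: field_simps)
    then have "int k = m * int n" by (metis of_int_eq_iff of_int_mult of_int_of_nat_eq)
    then have "int n dvd int k" by simp
    then show False using assms False by (simp add: nat_dvd_not_less)
  qed
  ultimately show ?thesis using False by (simp add: sum_gp_strict)
qed simp

lemma one_minus_power_factor:
  "(1 - (b::'a::{ring,monoid_mult})) * (\<Sum>k<n. b ^ k) = 1 - b ^ n"
proof (induction n)
  case (Suc n)
  then show ?case by (simp add: distrib_left) (simp add: left_diff_distrib)
qed simp

lemma scaleC_power: "(z *\<^sub>C (a::'a::cstar_algebra)) ^ n = z ^ n *\<^sub>C a ^ n"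
  by (induction n) (simp_all add: scaleC_mult_left scaleC_mult_right scaleC_scaleC mult.commute)

text \<open>
  Averaging the resolvent over the \<open>n\<close>-th roots of unity gives the inverse of
  \<open>1 - z\<^sup>n a\<^sup>n\<close>. If the resolvent exists on the closed unit disc, it is Lipschitz there,
  so the averages at \<open>1\<close> are uniformly close to those at \<open>t < 1\<close>, which tend to \<open>1\<close>.
  This replaces the Cauchy integral in the spectral radius formula (an argument of Rickart).
\<close>

lemma eventually_norm_power_less_one:
  assumes na: "norm (a::'a::cstar_algebra) \<le> 1"
    and sp: "\<And>z. z \<in> spectrum a \<Longrightarrow> cmod z \<noteq> 1"
  shows "\<forall>\<^sub>F n in sequentially. norm (a ^ n) < 1"
proof -
  \<comment> \<open>The Neumann inverse covers the open disc. On the circle \<open>inverse z\<close>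
    has modulus 1 too, so it lies off the spectrum.\<close>
  have "\<exists>b. b * (1 - z *\<^sub>C a) = 1 \<and> (1 - z *\<^sub>C a) * b = 1" if "cmod z \<le> 1" for z
  proof (cases "cmod z < 1")
    case True
    have "norm (z *\<^sub>C a) \<le> cmod z * 1"
      unfolding norm_scaleC by (rule mult_left_mono[OF na]) simp
    with True show ?thesis by (intro neumann_inverse) simp
  next
    case False
    with that have z: "cmod z = 1" "z \<noteq> 0" by auto
    then have "inverse z \<notin> spectrum a" by (metis sp norm_inverse inverse_1)
    then obtain b where b: "b * (inverse z *\<^sub>C 1 - a) = 1" "(inverse z *\<^sub>C 1 - a) * b = 1"
      unfolding spectrum_def by blast
    have e: "1 - z *\<^sub>C a = z *\<^sub>C (inverse z *\<^sub>C 1 - a)"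
      using z by (simp add: scaleC_simps)
    show ?thesis
      by (rule exI[of _ "inverse z *\<^sub>C b"])
        (use b z in \<open>simp add: e scaleC_mult_left scaleC_mult_right scaleC_scaleC\<close>)
  qed
  then obtain R where R: "R z * (1 - z *\<^sub>C a) = 1" "(1 - z *\<^sub>C a) * R z = 1"
    if "cmod z \<le> 1" for z by metis
  have resolvent: "norm (R z - R w) \<le> cmod (z - w) * norm (R z) * norm (R w)"
    if "cmod z \<le> 1" "cmod w \<le> 1" for z w
  proof -
    have "R z - R w = R z * ((1 - w *\<^sub>C a) * R w) - (R z * (1 - z *\<^sub>C a)) * R w"
      using R that by simp
    also have "\<dots> = (z - w) *\<^sub>C (R z * a * R w)"
      by (simp add: algebra_simps scaleC_mult_left scaleC_mult_right scaleC_simps)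
    also have "norm \<dots> \<le> cmod (z - w) * (norm (R z) * 1 * norm (R w))"
      unfolding norm_scaleC
      by (intro mult_left_mono order.trans[OF norm_mult_ineq] mult_right_mono mult_mono na) auto
    finally show ?thesis by (simp add: mult.assoc)
  qed
  have "continuous_on (cball 0 1) R"
    unfolding continuous_on_iff
  proof (intro ballI allI impI)
    fix w :: complex and e :: real assume w: "w \<in> cball 0 1" and e: "0 < e"
    define K where "K = norm (R w) + 1"
    have K: "K > 0" "norm (R w) \<le> K" unfolding K_def by (auto simp: add_nonneg_pos)
    \<comment> \<open>The first bound absorbs half of the norm of \<open>R z\<close> and yields
      \<open>norm (R z) \<le> 2 * K\<close>. With the second one the resolvent estimate is then at
      most e / 2.\<close>
    define d where "d = min (1 / (2 * K)) (e / (4 * K * K))"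
    have d: "d > 0" using K e by (simp add: d_def)
    show "\<exists>d>0. \<forall>z\<in>cball 0 1. dist z w < d \<longrightarrow> dist (R z) (R w) < e"
    proof (intro exI[of _ d] conjI ballI impI d)
      fix z :: complex assume z: "z \<in> cball 0 1" "dist z w < d"
      have zw: "cmod (z - w) < 1 / (2 * K)" "cmod (z - w) < e / (4 * K * K)"
        using z by (simp_all add: d_def dist_norm)
      have res: "norm (R z - R w) \<le> cmod (z - w) * norm (R z) * norm (R w)"
        using resolvent z w by simp
      have "cmod (z - w) * norm (R z) * norm (R w) \<le> (1 / (2 * K)) * norm (R z) * K"
        using zw K by (intro mult_mono) auto
      also have "\<dots> = norm (R z) / 2" using K by simp
      finally have "norm (R z) \<le> 2 * K"
        using res K norm_triangle_sub[of "R z" "R w"] by linarith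
      then have "cmod (z - w) * norm (R z) * norm (R w) \<le> cmod (z - w) * (2 * K) * K"
        using K by (intro mult_mono) auto
      also have "\<dots> \<le> e / (4 * K * K) * (2 * K) * K"
        using zw K by (intro mult_right_mono) auto
      also have "\<dots> < e" using K e by simp
      finally show "dist (R z) (R w) < e" using res by (simp add: dist_norm)
    qed
  qed
  then have "bounded (R ` cball 0 1)"
    by (intro compact_imp_bounded compact_continuous_image) auto
  then obtain M where M: "M > 0" "norm (R z) \<le> M" if "cmod z \<le> 1" for z
    unfolding bounded_pos by fastforce
  have M0: "M > 0" using M(1)[of 0] by simp
  define A where "A n z = (1 / of_nat n) *\<^sub>C (\<Sum>j<n. R (cis (2 * pi * real j / real n) * z))"
    for n :: nat and z
  have inv: "(1 - z ^ n *\<^sub>C a ^ n) * A n z = 1" if "n > 0" "cmod z \<le> 1" for n z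
  proof -
    let ?w = "\<lambda>j. cis (2 * pi * real j / real n)"
    \<comment> \<open>For b = w_j z a the power b^n = z^n a^n does not depend on j. Factoring out 1
      - b cancels the resolvent and leaves a finite geometric sum.\<close>
    have "(1 - z ^ n *\<^sub>C a ^ n) * R (?w j * z) = (\<Sum>k<n. ?w j ^ k *\<^sub>C (z ^ k *\<^sub>C a ^ k))" for j
    proof -
      have wn: "?w j ^ n = 1"
        using that cis_multiple_2pi[of "real j"] by (simp add: Complex.DeMoivre)
      let ?b = "(?w j * z) *\<^sub>C a"
      have bn: "?b ^ n = z ^ n *\<^sub>C a ^ n" by (simp add: scaleC_power power_mult_distrib wn)
      have "?b * (\<Sum>k<n. ?b ^ k) = (\<Sum>k<n. ?b ^ k) * ?b"
        by (simp only: sum_distrib_left sum_distrib_right power_commutes)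
      then have comm: "(1 - ?b) * (\<Sum>k<n. ?b ^ k) = (\<Sum>k<n. ?b ^ k) * (1 - ?b)"
        by (simp only: left_diff_distrib right_diff_distrib mult_1_left mult_1_right)
      have "(1 - ?b ^ n) * R (?w j * z) = (\<Sum>k<n. ?b ^ k) * ((1 - ?b) * R (?w j * z))"
        unfolding one_minus_power_factor[symmetric] comm by (simp add: mult.assoc)
      also have "\<dots> = (\<Sum>k<n. ?b ^ k)"
        using R(2)[of "?w j * z"] that by (simp add: norm_mult)
      finally show ?thesis unfolding bn by (simp add: scaleC_power power_mult_distrib scaleC_scaleC)
    qed
    then have "(1 - z ^ n *\<^sub>C a ^ n) * A n z
        = (1 / of_nat n) *\<^sub>C (\<Sum>j<n. \<Sum>k<n. ?w j ^ k *\<^sub>C (z ^ k *\<^sub>C a ^ k))"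
      by (simp add: A_def scaleC_mult_right sum_distrib_left)
    \<comment> \<open>After the exchange of sums the average over the roots of unity kills every
      term except k = 0.\<close>
    also have "(\<Sum>j<n. \<Sum>k<n. ?w j ^ k *\<^sub>C (z ^ k *\<^sub>C a ^ k))
        = (\<Sum>k<n. (\<Sum>j<n. ?w j ^ k) *\<^sub>C (z ^ k *\<^sub>C a ^ k))"
      by (subst sum.swap) (simp add: scaleC_sum_left)
    also have "\<dots> = (\<Sum>k<n. if k = 0 then of_nat n *\<^sub>C 1 else 0)"
      by (intro sum.cong refl) (auto simp: sum_root_of_unity_powers)
    also have "\<dots> = of_nat n *\<^sub>C 1" using that by (simp add: sum.delta)
    finally show ?thesis using that by (simp add: scaleC_scaleC)
  qed
  have average: "norm ((1 / of_nat n) *\<^sub>C (\<Sum>j<n. f j)) \<le> C"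
    if "n > 0" "\<And>j. norm (f j) \<le> C" for n C and f :: "nat \<Rightarrow> 'a"
  proof -
    have "norm (\<Sum>j<n. f j) \<le> real n * C"
      using sum_norm_le[of "{..<n}" f "\<lambda>_. C"] that by simp
    then show ?thesis using that by (simp add: norm_scaleC norm_divide field_simps)
  qed
  have A_bound: "norm (A n z) \<le> M" if "n > 0" "cmod z \<le> 1" for n z
    unfolding A_def using that M by (intro average) (auto simp: norm_mult)
  have A_diff: "norm (A n 1 - A n (of_real t)) \<le> (1 - t) * M * M"
    if "n > 0" "0 \<le> t" "t \<le> 1" for n t
    unfolding A_def scaleC_diff_right[symmetric] sum_subtractf[symmetric]
  proof (intro average that)
    fix j
    let ?w = "cis (2 * pi * real j / real n)"
    have "norm (R (?w * 1) - R (?w * of_real t))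
        \<le> cmod (?w * 1 - ?w * of_real t) * norm (R (?w * 1)) * norm (R (?w * of_real t))"
      using that by (intro resolvent) (auto simp: norm_mult)
    also have "cmod (?w * 1 - ?w * of_real t) = cmod (?w * of_real (1 - t))"
      by (simp add: algebra_simps)
    also have "\<dots> = 1 - t" using that by (simp only: norm_mult norm_cis norm_of_real) simp
    also have "(1 - t) * norm (R (?w * 1)) * norm (R (?w * of_real t)) \<le> (1 - t) * M * M"
      using that M0 by (intro mult_mono M) (auto simp: norm_mult)
    finally show "norm (R (?w * 1) - R (?w * of_real t)) \<le> (1 - t) * M * M" .
  qed
  \<comment> \<open>Chosen so that the Lipschitz error \<open>(1 - t) * M * M\<close> is at most 1/8
    while t stays in [0, 1).\<close>
  define t where "t = max 0 (1 - 1 / (8 * M * M))"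
  have t: "0 \<le> t" "t < 1" "(1 - t) * M * M \<le> 1 / 8"
  proof -
    have "(1 - t) * M * M \<le> (1 / (8 * M * M)) * M * M"
      using M0 by (intro mult_right_mono) (auto simp: t_def)
    then show "(1 - t) * M * M \<le> 1 / 8" using M0 by simp
  qed (use M0 in \<open>auto simp: t_def\<close>)
  have "(\<lambda>n. t ^ n * M) \<longlonglongrightarrow> 0 * M"
    by (intro tendsto_mult LIMSEQ_power_zero tendsto_const) (use t in auto)
  then have "\<forall>\<^sub>F n in sequentially. t ^ n * M < 1 / 8"
    by (intro order_tendstoD) auto
  moreover have "\<forall>\<^sub>F n :: nat in sequentially. n > 0" by (rule eventually_gt_at_top)
  ultimately show ?thesis
  proof eventually_elim
    case (elim n)
    have "A n (of_real t) - 1 = (of_real t ^ n *\<^sub>C a ^ n) * A n (of_real t)"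
      using inv[of n "of_real t"] elim t by (simp add: algebra_simps)
    also have "norm \<dots> \<le> (t ^ n * 1) * M"
    proof (intro order.trans[OF norm_mult_ineq] mult_mono A_bound)
      show "norm (of_real t ^ n *\<^sub>C a ^ n) \<le> t ^ n * 1"
        using mult_left_mono[OF norm_power_le_one[OF na, of n], of "t ^ n"] t
        by (simp add: norm_scaleC norm_power)
    qed (use elim t in auto)
    finally have 1: "norm (A n (of_real t) - 1) \<le> 1 / 8" using elim by simp
    have "norm (A n 1 - 1) \<le> norm (A n 1 - A n (of_real t)) + norm (A n (of_real t) - 1)"
      using norm_triangle_ineq[of "A n 1 - A n (of_real t)" "A n (of_real t) - 1"] by simp
    also have "\<dots> \<le> 1 / 4" using 1 A_diff[of n t] elim t by simp
    finally have 2: "norm (A n 1 - 1) \<le> 1 / 4" .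
    \<comment> \<open>A rearrangement of \<open>(1 - a ^ n) * A n 1 = 1\<close>. It bounds the norm
      of \<open>a ^ n\<close> by twice that of \<open>A n 1 - 1\<close>, hence by 1/2.\<close>
    have "a ^ n = (A n 1 - 1) - a ^ n * (A n 1 - 1)"
      using inv[of n 1] elim by (simp add: algebra_simps)
    also have "norm \<dots> \<le> norm (A n 1 - 1) + norm (a ^ n * (A n 1 - 1))"
      by (rule norm_triangle_ineq4)
    also have "norm (a ^ n * (A n 1 - 1)) \<le> 1 * norm (A n 1 - 1)"
      by (rule order.trans[OF norm_mult_ineq]) (intro mult_right_mono norm_power_le_one na, simp)
    finally show "norm (a ^ n) < 1" using 2 by simp
  qed
qed

text \<open>Normalise to norm 1. If no spectral point had modulus 1, all large powers would have
  norm below 1, against \<open>norm_selfadjoint_power\<close>.\<close>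

lemma selfadjoint_norm_in_spectrum:
  assumes sa: "star a = (a::'a::cstar_algebra)" and nz: "a \<noteq> 0"
  shows "\<exists>z\<in>spectrum a. cmod z = norm a"
proof (rule ccontr)
  assume none: "\<not> ?thesis"
  define r where "r = complex_of_real (1 / norm a)"
  have r: "r \<noteq> 0" "cmod r * norm a = 1" using nz by (simp_all add: r_def norm_divide)
  have nr: "norm (r *\<^sub>C a) = 1" by (simp add: norm_scaleC r)
  have "\<forall>\<^sub>F n in sequentially. norm ((r *\<^sub>C a) ^ n) < 1"
  proof (rule eventually_norm_power_less_one)
    fix z assume "z \<in> spectrum (r *\<^sub>C a)"
    then obtain y where y: "y \<in> spectrum a" "z = r * y"
      using spectrum_affine[OF r(1), of 0 a] by auto
    show "cmod z \<noteq> 1"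
    proof
      assume "cmod z = 1"
      then have "cmod r * cmod y = cmod r * norm a" using y r by (simp add: norm_mult)
      then have "cmod y = norm a" using r(1) by (metis mult_left_cancel norm_eq_zero)
      then show False using none y by blast
    qed
  qed (simp add: nr)
  then obtain N where N: "norm ((r *\<^sub>C a) ^ n) < 1" if "n \<ge> N" for n
    unfolding eventually_sequentially by blast
  have "star (r *\<^sub>C a) = r *\<^sub>C a" by (simp add: star_scaleC sa r_def)
  from norm_selfadjoint_power[OF this, of N] have "norm ((r *\<^sub>C a) ^ (2 ^ N)) = 1"
    by (simp add: nr)
  moreover have "N \<le> 2 ^ N" by (simp add: less_imp_le)
  ultimately show False using N[of "2 ^ N"] by simp
qed

lemma positive_norm_in_spectrum:
  assumes "positive (a::'a::cstar_algebra)" "a \<noteq> 0"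
  shows "complex_of_real (norm a) \<in> spectrum a"
proof -
  obtain z where z: "z \<in> spectrum a" "cmod z = norm a"
    using selfadjoint_norm_in_spectrum assms unfolding positive_def by blast
  then have "z \<in> \<real>\<^sub>\<ge>\<^sub>0" using assms by (auto simp: positive_def)
  then have "z = complex_of_real (norm a)"
    using z(2) by (metis nonneg_Reals_cases norm_of_real abs_of_nonneg)
  with z show ?thesis by simp
qed

section \<open>Extreme points below a sublinear functional\<close>

definition sublinear :: "('v::real_vector \<Rightarrow> real) \<Rightarrow> bool" where
  "sublinear p \<longleftrightarrow> (\<forall>x y. p (x + y) \<le> p x + p y) \<and> (\<forall>r\<ge>0. \<forall>x. p (r *\<^sub>R x) = r * p x)"

lemma sublinear_add: "sublinear p \<Longrightarrow> p (x + y) \<le> p x + p y"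
  and sublinear_scale: "sublinear p \<Longrightarrow> r \<ge> 0 \<Longrightarrow> p (r *\<^sub>R x) = r * p x"
  unfolding sublinear_def by blast+

lemma sublinear_zero: "sublinear p \<Longrightarrow> p 0 = 0"
  using sublinear_scale[of p 0 0] by simp

lemma sublinear_minus_le: "sublinear p \<Longrightarrow> - p (- x) \<le> p x"
  using sublinear_add[of p x "- x"] sublinear_zero[of p] by simp

text \<open>The linear functionals below \<open>steepen p a\<close> are those below \<open>p\<close> that agree with \<open>p\<close> at \<open>a\<close>.\<close>

definition steepen :: "('v::real_vector \<Rightarrow> real) \<Rightarrow> 'v \<Rightarrow> 'v \<Rightarrow> real" where
  "steepen p a x = (INF t\<in>{0..}. p (x + t *\<^sub>R a) - t * p a)"

text \<open>A bound independent of t: it keeps the infimum defining \<open>steepen\<close>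
  finite.\<close>

lemma steepen_lower:
  assumes "sublinear p" "t \<ge> 0"
  shows "- p (- x) \<le> p (x + t *\<^sub>R a) - t * p a"
  using sublinear_add[of p "x + t *\<^sub>R a" "- x"] sublinear_scale[of p t a] assms by simp

lemma steepen_bdd: "sublinear p \<Longrightarrow> bdd_below ((\<lambda>t. p (x + t *\<^sub>R a) - t * p a) ` {0..})"
  by (rule bdd_belowI[of _ "- p (- x)"]) (use steepen_lower in auto)

lemma steepen_le_at:
  assumes "sublinear p" "t \<ge> 0"
  shows "steepen p a x \<le> p (x + t *\<^sub>R a) - t * p a"
  unfolding steepen_def using assms by (intro cINF_lower steepen_bdd) auto

lemma steepen_greatest:
  assumes "\<And>t. t \<ge> 0 \<Longrightarrow> m \<le> p (x + t *\<^sub>R a) - t * p a"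
  shows "m \<le> steepen p a x"
  unfolding steepen_def using assms by (intro cINF_greatest) auto

lemma steepen_le: "sublinear p \<Longrightarrow> steepen p a x \<le> p x"
  using steepen_le_at[of p 0 a x] by simp

text \<open>The parameter t = 1 in the infimum. For a linear f below \<open>steepen p a\<close> it
  reads - f a <= - p a, which pins f a to \<open>p a\<close>.\<close>

lemma steepen_minus: "sublinear p \<Longrightarrow> steepen p a (- a) \<le> - p a"
  using steepen_le_at[of p 1 a "- a"] sublinear_zero[of p] by simp

lemma steepen_sublinear:
  assumes p: "sublinear p"
  shows "sublinear (steepen p a)"
  unfolding sublinear_def
proof (intro conjI allI impI)
  fix x y
  \<comment> \<open>The parameter t + s on the left serves both terms, so the infima over t and s
    can be taken one after the other.\<close>
  have "steepen p a (x + y) - (p (y + s *\<^sub>R a) - s * p a) \<le> p (x + t *\<^sub>R a) - t * p a"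
    if "t \<ge> 0" "s \<ge> 0" for s t
    using steepen_le_at[OF p, of "t + s" a "x + y"] that
      sublinear_add[OF p, of "x + t *\<^sub>R a" "y + s *\<^sub>R a"]
    by (simp add: algebra_simps)
  then have "steepen p a (x + y) - (p (y + s *\<^sub>R a) - s * p a) \<le> steepen p a x"
    if "s \<ge> 0" for s
    using that by (intro steepen_greatest) auto
  then have "steepen p a (x + y) - steepen p a x \<le> p (y + s *\<^sub>R a) - s * p a" if "s \<ge> 0" for s
    using that by (simp add: algebra_simps)
  then have "steepen p a (x + y) - steepen p a x \<le> steepen p a y"
    by (rule steepen_greatest)
  then show "steepen p a (x + y) \<le> steepen p a x + steepen p a y" by simp
next
  fix r :: real and x assume r: "r \<ge> 0"
  \<comment> \<open>Replacing t by t / r gives this inequality; its instance for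
    \<open>inverse r\<close> gives the reverse one.\<close>
  have le: "r * steepen p a x \<le> steepen p a (r *\<^sub>R x)" if "r > 0" for r x
  proof (rule steepen_greatest)
    fix t :: real assume t: "t \<ge> 0"
    have "r * steepen p a x \<le> r * (p (x + (t / r) *\<^sub>R a) - t / r * p a)"
      using that t by (intro mult_left_mono steepen_le_at p) auto
    also have "\<dots> = p (r *\<^sub>R (x + (t / r) *\<^sub>R a)) - t * p a"
      using that by (simp add: sublinear_scale[OF p] right_diff_distrib)
    also have "r *\<^sub>R (x + (t / r) *\<^sub>R a) = r *\<^sub>R x + t *\<^sub>R a"
      using that by (simp add: scaleR_add_right)
    finally show "r * steepen p a x \<le> p (r *\<^sub>R x + t *\<^sub>R a) - t * p a" .
  qed
  show "steepen p a (r *\<^sub>R x) = r * steepen p a x"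
  proof (cases "r = 0")
    case True
    have "steepen p a 0 = 0"
      using steepen_le[OF p, of a 0] sublinear_zero[OF p]
      by (intro antisym steepen_greatest) (simp_all add: sublinear_scale[OF p])
    with True show ?thesis by simp
  next
    case False
    with r have r: "r > 0" by simp
    have "inverse r * steepen p a (r *\<^sub>R x) \<le> steepen p a (inverse r *\<^sub>R r *\<^sub>R x)"
      by (rule le) (use r in simp)
    then have "steepen p a (r *\<^sub>R x) \<le> r * steepen p a x"
      using r by (simp add: field_simps)
    then show ?thesis using le[OF r] by (rule antisym)
  qed
qed

text \<open>The linear functionals below \<open>q\<close> form a face of the set of those below \<open>p\<close>.\<close>

definition face_functional :: "('v::real_vector \<Rightarrow> real) \<Rightarrow> ('v \<Rightarrow> real) \<Rightarrow> bool" where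
  "face_functional p q \<longleftrightarrow> sublinear q \<and> (\<forall>x. q x \<le> p x) \<and>
     (\<forall>f g u. linear f \<longrightarrow> linear g \<longrightarrow> (\<forall>x. f x \<le> p x) \<longrightarrow> (\<forall>x. g x \<le> p x) \<longrightarrow>
        0 < u \<longrightarrow> u < 1 \<longrightarrow> (\<forall>x. (1 - u) * f x + u * g x \<le> q x) \<longrightarrow>
        (\<forall>x. f x \<le> q x \<and> g x \<le> q x))"

lemma face_functional_refl: "sublinear p \<Longrightarrow> face_functional p p"
  unfolding face_functional_def by blast

lemma face_functionalD:
  assumes "face_functional p q" "linear f" "linear g" "\<And>x. f x \<le> p x" "\<And>x. g x \<le> p x"
    "0 < u" "u < 1" "\<And>x. (1 - u) * f x + u * g x \<le> q x"
  shows "f x \<le> q x" "g x \<le> q x"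
  using assms unfolding face_functional_def by blast+

text \<open>Attaining the maximal value \<open>q a\<close> cuts out a face. If a convex combination
  of f and g attains it and neither exceeds it, both attain it. Then f x = f (x + t a) - t
  \<open>q a\<close> for all t, and likewise for g.\<close>

lemma face_functional_steepen:
  assumes q: "face_functional p q"
  shows "face_functional p (steepen q a)"
proof -
  have sq: "sublinear q" and qp: "\<And>x. q x \<le> p x" using q unfolding face_functional_def by auto
  have "f x \<le> steepen q a x \<and> g x \<le> steepen q a x"
    if f: "linear f" and g: "linear g" and fp: "\<forall>x. f x \<le> p x" and gp: "\<forall>x. g x \<le> p x"
      and u: "0 < u" "u < 1" and le: "\<forall>x. (1 - u) * f x + u * g x \<le> steepen q a x" for f g u x
  proof -
    have fgq: "f x \<le> q x" "g x \<le> q x" for x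
      using face_functionalD[OF q f g _ _ u, of x] fp gp le steepen_le[OF sq]
      by (blast intro: order.trans)+
    have "(1 - u) * f (- a) + u * g (- a) \<le> - q a"
      using le steepen_minus[OF sq, of a] by (blast intro: order.trans)
    then have ge: "q a \<le> (1 - u) * f a + u * g a"
      by (simp add: linear_neg[OF f] linear_neg[OF g])
    have "(1 - u) * f a \<le> (1 - u) * q a" "u * g a \<le> u * q a"
      using fgq u by (auto intro: mult_left_mono)
    with ge have "(1 - u) * q a \<le> (1 - u) * f a" "u * q a \<le> u * g a"
      by (simp_all add: algebra_simps)
    then have fa: "f a = q a" and ga: "g a = q a"
      using fgq[of a] u by (simp_all add: antisym)
    show ?thesis
    proof (intro conjI steepen_greatest)
      fix t :: real
      show "f x \<le> q (x + t *\<^sub>R a) - t * q a"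
        using fgq(1)[of "x + t *\<^sub>R a"] by (simp add: linear_add[OF f] linear_scale[OF f] fa)
      show "g x \<le> q (x + t *\<^sub>R a) - t * q a"
        using fgq(2)[of "x + t *\<^sub>R a"] by (simp add: linear_add[OF g] linear_scale[OF g] ga)
    qed
  qed
  then show ?thesis
    unfolding face_functional_def
    using steepen_sublinear[OF sq] order.trans[OF steepen_le[OF sq] qp] by blast
qed

text \<open>Subadditivity is where the chain condition enters: values of q at x and of r at y can
  both be replaced by those of the smaller of q and r. The bound - p (- x) keeps the infimum
  finite.\<close>

lemma face_functional_chain_INF:
  assumes ne: "Q \<noteq> {}" and face: "\<And>q. q \<in> Q \<Longrightarrow> face_functional p q"
    and chain: "\<And>q r. q \<in> Q \<Longrightarrow> r \<in> Q \<Longrightarrow> (\<forall>x. q x \<le> r x) \<or> (\<forall>x. r x \<le> q x)"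
  shows "face_functional p (\<lambda>x. INF q\<in>Q. q x)" (is "face_functional p ?m")
    and "\<And>q x. q \<in> Q \<Longrightarrow> (INF q\<in>Q. q x) \<le> q x"
proof -
  have sub: "sublinear q" and qp: "q x \<le> p x" if "q \<in> Q" for q x
    using face[OF that] unfolding face_functional_def by auto
  have bdd: "bdd_below ((\<lambda>q. q x) ` Q)" for x
  proof (rule bdd_belowI[of _ "- p (- x)"])
    fix y assume "y \<in> (\<lambda>q. q x) ` Q"
    then obtain q where "q \<in> Q" "y = q x" by blast
    then show "- p (- x) \<le> y"
      using sublinear_minus_le[OF sub, of q x] qp[of q "- x"] by simp
  qed
  show lower: "?m x \<le> q x" if "q \<in> Q" for q x
    using that by (intro cINF_lower bdd)
  have greatest: "b \<le> ?m x" if "\<And>q. q \<in> Q \<Longrightarrow> b \<le> q x" for b x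
    using that by (intro cINF_greatest ne)
  have "?m (x + y) \<le> ?m x + ?m y" for x y
  proof -
    have "?m (x + y) - r y \<le> q x" if qr: "q \<in> Q" "r \<in> Q" for q r
    proof -
      obtain s where s: "s \<in> Q" "s x \<le> q x" "s y \<le> r y"
        using chain[OF qr] qr by blast
      then show ?thesis
        using lower[of s "x + y"] sublinear_add[OF sub, of s x y] by simp
    qed
    then have "?m (x + y) - r y \<le> ?m x" if "r \<in> Q" for r
      using that by (intro greatest)
    then have "?m (x + y) - ?m x \<le> ?m y"
      by (intro greatest) (simp add: algebra_simps)
    then show ?thesis by simp
  qed
  moreover have "?m (r *\<^sub>R x) = r * ?m x" if r: "r \<ge> 0" for r x
  proof -
    have le: "r * ?m x \<le> ?m (r *\<^sub>R x)" if "r \<ge> 0" for r x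
      using that lower by (intro greatest) (simp add: sublinear_scale[OF sub] mult_left_mono)
    show ?thesis
    proof (cases "r = 0")
      case True
      have "(\<lambda>q. q (0::'a)) ` Q = {0}" using ne by (auto simp: sublinear_zero[OF sub])
      then show ?thesis using True by simp
    next
      case False
      with r have r: "r > 0" by simp
      have "inverse r * ?m (r *\<^sub>R x) \<le> ?m (inverse r *\<^sub>R r *\<^sub>R x)"
        by (rule le) (use r in simp)
      then have "?m (r *\<^sub>R x) \<le> r * ?m x" using r by (simp add: field_simps)
      with le[of r x] r show ?thesis by (simp add: antisym)
    qed
  qed
  ultimately have "sublinear ?m" unfolding sublinear_def by blast
  moreover have "?m x \<le> p x" for x
    using ne lower qp by (meson ex_in_conv order.trans)
  moreover have "f x \<le> ?m x \<and> g x \<le> ?m x"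
    if fg: "linear f" "linear g" "\<forall>x. f x \<le> p x" "\<forall>x. g x \<le> p x" "0 < u" "u < 1"
      and le: "\<forall>x. (1 - u) * f x + u * g x \<le> ?m x" for f g u x
  proof -
    have "f x \<le> q x \<and> g x \<le> q x" if "q \<in> Q" for q
    proof -
      have "(1 - u) * f x + u * g x \<le> q x" for x using le lower[OF that] by (meson order.trans)
      then show ?thesis using face_functionalD[OF face[OF that] fg(1,2) _ _ fg(5,6)] fg by blast
    qed
    then show ?thesis by (auto intro: greatest)
  qed
  ultimately show "face_functional p ?m" unfolding face_functional_def by blast
qed

text \<open>
  Hahn-Banach and Krein-Milman in one stroke: a minimal face functional is linear, because
  steepening cannot lower it, and the face it describes is then a single functional.
\<close>

theorem extreme_functional_below:
  assumes q: "face_functional p q"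
  obtains g where "linear g" "\<forall>x. g x \<le> q x"
    "\<forall>f h u. linear f \<and> linear h \<and> (\<forall>x. f x \<le> p x) \<and> (\<forall>x. h x \<le> p x) \<and>
       0 < u \<and> u < 1 \<and> (\<forall>x. (1 - u) * f x + u * h x = g x) \<longrightarrow> f = g \<and> h = g"
proof -
  define S where "S = {r. face_functional p r \<and> (\<forall>x. r x \<le> q x)}"
  \<comment> \<open>The order is reversed, so that Zorn's maximal element is a minimal
    functional.\<close>
  have po: "partial_order_on S (relation_of (\<lambda>r s. \<forall>x. s x \<le> r x) S)"
    by (rule partial_order_on_relation_ofI) (auto intro: order.trans simp: fun_eq_iff antisym)
  have "\<exists>m\<in>S. \<forall>r\<in>S. (\<forall>x. r x \<le> m x) \<longrightarrow> r = m"
  proof (rule predicate_Zorn[OF po])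
    fix C assume C: "C \<in> Chains (relation_of (\<lambda>r s. \<forall>x. s x \<le> r x) S)"
    then have CS: "C \<subseteq> S" by (auto simp: Chains_def relation_of_def)
    show "\<exists>u\<in>S. \<forall>r\<in>C. \<forall>x. u x \<le> r x"
    proof (cases "C = {}")
      case True
      then show ?thesis using q unfolding S_def by blast
    next
      case False
      have face: "face_functional p r" if "r \<in> C" for r using that CS by (auto simp: S_def)
      have ch: "(\<forall>x. r x \<le> s x) \<or> (\<forall>x. s x \<le> r x)" if "r \<in> C" "s \<in> C" for r s
        using C that unfolding Chains_def relation_of_def by blast
      have m: "face_functional p (\<lambda>x. INF s\<in>C. s x)"
        by (rule face_functional_chain_INF(1)[OF False face ch])
      have mle: "(INF s\<in>C. s x) \<le> r x" if "r \<in> C" for r x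
        by (rule face_functional_chain_INF(2)[OF False face ch that])
      obtain r where r: "r \<in> C" using False by blast
      then have "r \<in> S" using CS by blast
      then have "(INF s\<in>C. s x) \<le> q x" for x
        using mle[OF r, of x] by (auto simp: S_def intro: order.trans)
      then show ?thesis using m mle by (intro bexI[of _ "\<lambda>x. INF s\<in>C. s x"]) (auto simp: S_def)
    qed
  qed
  then obtain m where mS: "m \<in> S" and minS: "\<And>r. r \<in> S \<Longrightarrow> \<forall>x. r x \<le> m x \<Longrightarrow> r = m" by blast
  from mS have m: "face_functional p m" "m x \<le> q x" for x unfolding S_def by auto
  have min: "r = m" if "face_functional p r" "\<And>x. r x \<le> m x" for r
    using that m(2) by (intro minS) (auto simp: S_def intro: order.trans)
  have sm: "sublinear m" using m unfolding face_functional_def by blast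
  \<comment> \<open>Steepening stays in the family and below \<open>m\<close>, so minimality returns
    \<open>m\<close> itself, and \<open>steepen_minus\<close> makes it odd.\<close>
  have neg: "m (- a) = - m a" for a
  proof -
    have "steepen m a = m" by (rule min) (intro face_functional_steepen m steepen_le sm)+
    then show ?thesis using steepen_minus[OF sm, of a] sublinear_minus_le[OF sm, of "- a"] by simp
  qed
  have "m x + m y \<le> m (x + y)" for x y
    using sublinear_add[OF sm, of "- x" "- y"] neg[of "x + y"] neg[of x] neg[of y] by simp
  then have add: "m (x + y) = m x + m y" for x y
    using sublinear_add[OF sm, of x y] by (simp add: antisym)
  have lin: "linear m"
  proof (rule linearI)
    show "m (r *\<^sub>R x) = r *\<^sub>R m x" for r x
    proof (cases "r \<ge> 0")
      case False
      then show ?thesis using sublinear_scale[OF sm, of "- r" x] neg[of "r *\<^sub>R x"] by simp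
    qed (simp add: sublinear_scale[OF sm])
  qed (rule add)
  \<comment> \<open>Below a linear functional there is no other linear one: compare the values at x
    and - x.\<close>
  have eq: "f = m" if "linear f" "\<And>x. f x \<le> m x" for f
  proof
    fix x
    show "f x = m x"
      using that(2)[of x] that(2)[of "- x"] by (simp add: neg linear_neg[OF that(1)])
  qed
  show thesis
  proof (rule that[OF lin], intro allI m(2), intro allI impI, elim conjE)
    fix f h :: "'a \<Rightarrow> real" and u :: real
    assume *: "linear f" "linear h" "\<forall>x. f x \<le> p x" "\<forall>x. h x \<le> p x" "0 < u" "u < 1"
      "\<forall>x. (1 - u) * f x + u * h x = m x"
    have "f x \<le> m x" "h x \<le> m x" for x
      using face_functionalD[OF m(1) *(1,2) _ _ *(5,6), of x] *(3,4,7) by auto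
    then show "f = m \<and> h = m" using eq *(1,2) by blast
  qed
qed

section \<open>Pure states\<close>

text \<open>
  The real parts of states are exactly the linear functionals below this seminorm that map \<open>1\<close>
  to \<open>1\<close>; it vanishes on \<open>\<i>h\<close> for selfadjoint \<open>h\<close>, so these functionals are hermitian.
\<close>

definition hermitian_norm :: "'a::cstar_algebra \<Rightarrow> real" where
  "hermitian_norm x = norm ((1 / 2) *\<^sub>R (x + star x))"

lemma hermitian_norm_selfadjoint: "star h = h \<Longrightarrow> hermitian_norm h = norm h"
  by (simp add: hermitian_norm_def scaleR_2[symmetric])

lemma hermitian_norm_le: "hermitian_norm x \<le> norm x"
  unfolding hermitian_norm_def using norm_triangle_ineq[of x "star x"] by simp

lemma hermitian_norm_i_selfadjoint: "star h = h \<Longrightarrow> hermitian_norm (\<i> *\<^sub>C h) = 0"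
  by (simp add: hermitian_norm_def star_scaleC scaleC_minus_left)

lemma sublinear_hermitian_norm: "sublinear (hermitian_norm :: 'a::cstar_algebra \<Rightarrow> real)"
  unfolding sublinear_def
proof (intro conjI allI impI)
  fix x y :: 'a
  have "(1 / 2) *\<^sub>R (x + y + star (x + y))
      = (1 / 2) *\<^sub>R (x + star x) + (1 / 2) *\<^sub>R (y + star y)"
    by (simp add: star_add algebra_simps)
  then show "hermitian_norm (x + y) \<le> hermitian_norm x + hermitian_norm y"
    unfolding hermitian_norm_def by (metis norm_triangle_ineq)
  fix r :: real assume "0 \<le> r"
  have "(1 / 2) *\<^sub>R (r *\<^sub>R x + star (r *\<^sub>R x)) = r *\<^sub>R ((1 / 2) *\<^sub>R (x + star x))"
    by (simp add: star_scaleR scaleR_add_right)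
  then show "hermitian_norm (r *\<^sub>R x) = r * hermitian_norm x"
    using \<open>0 \<le> r\<close> unfolding hermitian_norm_def by (simp only: norm_scaleR abs_of_nonneg)
qed

section \<open>Norm estimates for positive elements\<close>

lemma positive_norm_minus_selfadjoint:
  assumes "star h = (h::'a::cstar_algebra)"
  shows "positive (norm h *\<^sub>R 1 - h)"
proof -
  have e: "norm h *\<^sub>R 1 - h = complex_of_real (norm h) *\<^sub>C 1 + (-1) *\<^sub>C h"
    by (simp add: scaleC_of_real scaleC_minus_left)
  have "complex_of_real (norm h) + (-1) * z \<in> \<real>\<^sub>\<ge>\<^sub>0" if z: "z \<in> spectrum h" for z
  proof -
    obtain r where "z = complex_of_real r"
      using spectrum_selfadjoint_real[OF assms z] by (auto elim: Reals_cases)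
    moreover have "cmod z \<le> norm h" using z by (rule spectrum_norm_le)
    ultimately have "complex_of_real (norm h) + (-1) * z = complex_of_real (norm h - r)"
      "norm h - r \<ge> 0" by auto
    then show ?thesis by (simp only: nonneg_Reals_of_real_iff)
  qed
  then have "spectrum (norm h *\<^sub>R 1 - h) \<subseteq> \<real>\<^sub>\<ge>\<^sub>0"
    unfolding e by (subst spectrum_affine) auto
  then show ?thesis by (simp add: positive_def star_diff star_scaleR assms)
qed

text \<open>The element on the left is positive, so its norm is one of its spectral points, that is
  \<open>norm b\<close> minus a nonnegative spectral point of b. The estimate turns a norm bound on
  a functional into positivity.\<close>

lemma norm_minus_positive_le:
  assumes "positive (b::'a::cstar_algebra)"
  shows "norm (norm b *\<^sub>R 1 - b) \<le> norm b"
proof (cases "norm b *\<^sub>R 1 - b = 0")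
  case False
  have sb: "star b = b" using assms by (simp add: positive_def)
  have e: "norm b *\<^sub>R 1 - b = complex_of_real (norm b) *\<^sub>C 1 + (-1) *\<^sub>C b"
    by (simp add: scaleC_of_real scaleC_minus_left)
  obtain z where z: "z \<in> spectrum (norm b *\<^sub>R 1 - b)" "z = norm (norm b *\<^sub>R 1 - b)"
    using positive_norm_in_spectrum[OF positive_norm_minus_selfadjoint[OF sb] False] by blast
  then obtain w where w: "w \<in> spectrum b" "z = complex_of_real (norm b) - w"
    unfolding e by (subst (asm) spectrum_affine) auto
  obtain r where "w = complex_of_real r" "r \<ge> 0"
    using w assms by (auto simp: positive_def elim!: nonneg_Reals_cases)
  with w z have "complex_of_real (norm (norm b *\<^sub>R 1 - b)) = complex_of_real (norm b - r)" by simp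
  then have "norm (norm b *\<^sub>R 1 - b) = norm b - r" by (simp only: of_real_eq_iff)
  with \<open>r \<ge> 0\<close> show ?thesis by simp
qed simp

text \<open>The norm of a positive element is a spectral point, and adding t shifts it. Hence
  steepening at 1 does not lower the value at \<open>a\<close>.\<close>

lemma norm_add_one_positive:
  assumes "positive (a::'a::cstar_algebra)" "a \<noteq> 0" "t \<ge> 0"
  shows "norm (a + t *\<^sub>R 1) = norm a + t"
proof (rule antisym)
  show "norm (a + t *\<^sub>R 1) \<le> norm a + t"
    using norm_triangle_ineq[of a "t *\<^sub>R 1"] norm_one_eq[OF assms(2)] assms(3) by simp
  have "complex_of_real t + 1 * complex_of_real (norm a) \<in> spectrum (complex_of_real t *\<^sub>C 1 + 1 *\<^sub>C a)"
    by (rule spectrum_affine_imp[OF positive_norm_in_spectrum[OF assms(1,2)]]) simp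
  from spectrum_norm_le[OF this]
  have "cmod (complex_of_real (t + norm a)) \<le> norm (a + t *\<^sub>R 1)"
    by (simp add: scaleC_of_real add.commute)
  then show "norm a + t \<le> norm (a + t *\<^sub>R 1)"
    using assms(3) by (simp only: norm_of_real)
qed

section \<open>States and their real parts\<close>

lemma state_scaleC: "f \<in> states \<Longrightarrow> blinfun_apply f (c *\<^sub>C a) = c * blinfun_apply f a"
  and state_positive: "f \<in> states \<Longrightarrow> positive a \<Longrightarrow> blinfun_apply f a \<in> \<real>\<^sub>\<ge>\<^sub>0"
  and state_one: "f \<in> states \<Longrightarrow> blinfun_apply f 1 = 1"
  unfolding states_def complex_dual_def by auto

lemma state_selfadjoint:
  assumes f: "f \<in> states" and h: "star h = (h::'a::cstar_algebra)"
  shows "blinfun_apply f h \<in> \<real>" "Re (blinfun_apply f h) \<le> norm h"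
proof -
  obtain r where r: "blinfun_apply f (norm h *\<^sub>R 1 - h) = complex_of_real r" "r \<ge> 0"
    using state_positive[OF f positive_norm_minus_selfadjoint[OF h]] by (auto elim: nonneg_Reals_cases)
  have "blinfun_apply f (norm h *\<^sub>R 1 - h) = of_real (norm h) - blinfun_apply f h"
    using state_one[OF f] by (simp add: blinfun.diff_right blinfun.scaleR_right scaleR_conv_of_real)
  with r have e: "blinfun_apply f h = complex_of_real (norm h - r)"
    by (simp add: algebra_simps)
  show "blinfun_apply f h \<in> \<real>" by (simp only: e Reals_of_real)
  show "Re (blinfun_apply f h) \<le> norm h" using r by (simp add: e)
qed

lemma hermitian_decomposition:
  obtains h k where "star h = h" "star k = k" "x = h + \<i> *\<^sub>C k"
    "hermitian_norm x = norm h" "star x = h - \<i> *\<^sub>C (k::'a::cstar_algebra)"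
proof
  let ?h = "(1 / 2) *\<^sub>R (x + star x)" and ?k = "(- \<i> / 2) *\<^sub>C (x - star x)"
  show "star ?h = ?h" by (simp add: star_scaleR star_add star_star add.commute)
  show "star ?k = ?k" by (simp add: star_scaleC star_diff star_star scaleC_diff_right scaleC_minus_left)
  have k: "\<i> *\<^sub>C ?k = (1 / 2) *\<^sub>R (x - star x)"
    by (simp add: scaleC_scaleC scaleC_of_real[symmetric])
  have "(1 / 2) *\<^sub>R x + (1 / 2) *\<^sub>R x = x" "(1 / 2) *\<^sub>R star x + (1 / 2) *\<^sub>R star x = star x"
    by (simp_all add: scaleR_add_left[symmetric])
  then show "x = ?h + \<i> *\<^sub>C ?k" "star x = ?h - \<i> *\<^sub>C ?k"
    unfolding k by (simp_all add: scaleR_add_right scaleR_diff_right)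
  show "hermitian_norm x = norm ?h" by (simp add: hermitian_norm_def)
qed

lemma Re_state_le_hermitian_norm:
  assumes f: "f \<in> states"
  shows "Re (blinfun_apply f x) \<le> hermitian_norm x"
proof -
  obtain h k where hk: "star h = h" "star k = k" "x = h + \<i> *\<^sub>C k" "hermitian_norm x = norm h"
    by (rule hermitian_decomposition)
  have "Re (blinfun_apply f x) = Re (blinfun_apply f h)"
    using state_selfadjoint(1)[OF f hk(2)]
    by (simp add: hk(3) blinfun.add_right state_scaleC[OF f] complex_is_Real_iff)
  then show ?thesis using state_selfadjoint(2)[OF f hk(1)] hk by simp
qed

lemma state_star:
  assumes f: "f \<in> states"
  shows "blinfun_apply f (star x) = cnj (blinfun_apply f x)"
proof -
  obtain h k where hk: "star h = h" "star k = k" "x = h + \<i> *\<^sub>C k" "star x = h - \<i> *\<^sub>C k"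
    by (rule hermitian_decomposition)
  show ?thesis
    using state_selfadjoint(1)[OF f hk(1)] state_selfadjoint(1)[OF f hk(2)]
    by (subst hk(4), subst hk(3))
      (simp add: Reals_cnj_iff blinfun.add_right blinfun.diff_right state_scaleC[OF f])
qed

text \<open>By complex linearity the imaginary part at x is minus the real part at
  \<open>\<i> *\<^sub>C x\<close>.\<close>

lemma state_eqI:
  assumes "f \<in> states" "g \<in> states" "\<And>x. Re (blinfun_apply f x) = Re (blinfun_apply g x)"
  shows "f = g"
proof (rule blinfun_eqI)
  fix x
  show "blinfun_apply f x = blinfun_apply g x"
    using assms(3)[of x] assms(3)[of "\<i> *\<^sub>C x"] assms(1,2)
    by (simp add: complex_eq_iff state_scaleC)
qed

lemma linear_Re_blinfun: "linear (\<lambda>x. Re (blinfun_apply f x))"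
  by (rule linearI) (simp_all add: blinfun.add_right blinfun.scaleR_right)

text \<open>The usual complexification g x - i g (i x). It is real on selfadjoint elements because
  \<open>hermitian_norm\<close> vanishes on i h. For positive b, evaluating g at
  \<open>norm b *\<^sub>R 1 - b\<close> gives g b >= 0.\<close>

lemma state_of_functional:
  fixes g :: "'a::cstar_algebra \<Rightarrow> real"
  assumes g: "linear g" and le: "\<And>x. g x \<le> hermitian_norm x" and g1: "g 1 = 1"
  obtains f where "f \<in> states" "\<And>x. Re (blinfun_apply f x) = g x"
proof -
  let ?f = "\<lambda>x. Complex (g x) (- g (\<i> *\<^sub>C x))"
  have bound: "\<bar>g x\<bar> \<le> norm x" for x
    using le[of x] le[of "- x"] hermitian_norm_le[of x] hermitian_norm_le[of "- x"]
    by (simp add: linear_neg[OF g])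
  have scR: "\<i> *\<^sub>C (r *\<^sub>R x) = r *\<^sub>R (\<i> *\<^sub>C x)" for r and x :: 'a
    by (simp add: scaleC_of_real[symmetric] scaleC_scaleC mult.commute)
  have bl: "bounded_linear ?f"
  proof (rule bounded_linear_intro[where K=2])
    show "?f (x + y) = ?f x + ?f y" for x y
      by (simp add: complex_eq_iff linear_add[OF g] scaleC_add_right)
    show "?f (r *\<^sub>R x) = r *\<^sub>R ?f x" for r x
      by (simp add: complex_eq_iff linear_scale[OF g] scR)
    show "norm (?f x) \<le> norm x * 2" for x
      using cmod_le[of "?f x"] bound[of x] bound[of "\<i> *\<^sub>C x"] by (simp add: norm_scaleC)
  qed
  define f where "f = Blinfun ?f"
  have f: "blinfun_apply f x = ?f x" for x
    unfolding f_def by (simp add: bounded_linear_Blinfun_apply[OF bl])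
  have gC: "g (c *\<^sub>C x) = Re c * g x + Im c * g (\<i> *\<^sub>C x)" for c x
  proof -
    have "c *\<^sub>C x = Re c *\<^sub>R x + Im c *\<^sub>R (\<i> *\<^sub>C x)"
      unfolding scaleC_of_real[symmetric] scaleC_scaleC scaleC_add_left[symmetric]
      by (rule arg_cong[where f="\<lambda>c. c *\<^sub>C x"]) (simp add: complex_eq_iff)
    then show ?thesis by (simp add: linear_add[OF g] linear_scale[OF g])
  qed
  have "blinfun_apply f (c *\<^sub>C x) = c * blinfun_apply f x" for c x
    using gC[of c x] gC[of "\<i> * c" x] by (simp add: f complex_eq_iff scaleC_scaleC)
  then have "f \<in> complex_dual" by (simp add: complex_dual_def)
  moreover have im: "g (\<i> *\<^sub>C h) = 0" if "star h = h" for h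
    using le[of "\<i> *\<^sub>C h"] le[of "- (\<i> *\<^sub>C h)"] hermitian_norm_i_selfadjoint[OF that]
      hermitian_norm_i_selfadjoint[of "- h"] that
    by (simp add: star_minus scaleC_minus_right linear_neg[OF g])
  moreover have "blinfun_apply f b \<in> \<real>\<^sub>\<ge>\<^sub>0" if "positive b" for b
  proof -
    have sb: "star b = b" using that by (simp add: positive_def)
    have "g (norm b *\<^sub>R 1 - b) \<le> norm b"
      using le[of "norm b *\<^sub>R 1 - b"] norm_minus_positive_le[OF that]
        hermitian_norm_le[of "norm b *\<^sub>R 1 - b"] by linarith
    then have "g b \<ge> 0" by (simp add: linear_diff[OF g] linear_scale[OF g] g1)
    then show ?thesis using im[OF sb] by (simp add: f complex_nonneg_Reals_iff)
  qed
  moreover have "blinfun_apply f 1 = 1" using im[of 1] by (simp add: f g1 complex_eq_iff)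
  ultimately have "f \<in> states" by (simp add: states_def)
  then show thesis by (rule that) (simp add: f)
qed

text \<open>Steepening at 1 selects the states, and steepening again at \<open>a\<close> selects
  those of maximal value at \<open>a\<close>. An extreme functional in this face is extreme among
  all functionals below \<open>hermitian_norm\<close>, so the state it comes from is pure.\<close>

theorem pure_state_attaining_norm:
  assumes a: "positive (a::'a::cstar_algebra)" "a \<noteq> 0"
  obtains f where "f \<in> pure_states" "blinfun_apply f a = of_real (norm a)"
proof -
  let ?p = "hermitian_norm :: 'a \<Rightarrow> real"
  let ?p1 = "steepen ?p 1"
  have n1: "norm (1::'a) = 1" by (rule norm_one_eq[OF a(2)])
  have p1: "?p 1 = 1" by (simp add: hermitian_norm_selfadjoint n1)
  have sa: "star a = a" using a by (simp add: positive_def)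
  have s1: "sublinear ?p1" by (intro steepen_sublinear sublinear_hermitian_norm)
  have "face_functional ?p (steepen ?p1 a)"
    by (intro face_functional_steepen face_functional_refl sublinear_hermitian_norm)
  then obtain g where g: "linear g" "\<forall>x. g x \<le> steepen ?p1 a x"
    and extreme: "\<forall>f h u. linear f \<and> linear h \<and> (\<forall>x. f x \<le> ?p x) \<and> (\<forall>x. h x \<le> ?p x) \<and>
       0 < u \<and> u < 1 \<and> (\<forall>x. (1 - u) * f x + u * h x = g x) \<longrightarrow> f = g \<and> h = g"
    by (rule extreme_functional_below)
  have gp1: "g x \<le> ?p1 x" for x using g(2) steepen_le[OF s1] by (blast intro: order.trans)
  have gp: "g x \<le> ?p x" for x
    using gp1 steepen_le[OF sublinear_hermitian_norm] by (blast intro: order.trans)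
  have "g (- 1) \<le> - 1"
    using gp1[of "- 1"] steepen_minus[OF sublinear_hermitian_norm, of "1::'a"] p1 by simp
  then have g1: "g 1 = 1" using gp[of 1] p1 by (simp add: linear_neg[OF g(1)])
  have "norm a \<le> ?p1 a"
  proof (rule steepen_greatest)
    fix t :: real assume t: "t \<ge> 0"
    have "?p (a + t *\<^sub>R 1) = norm a + t"
      using norm_add_one_positive[OF a t]
      by (subst hermitian_norm_selfadjoint) (simp_all add: star_add star_scaleR sa)
    then show "norm a \<le> ?p (a + t *\<^sub>R 1) - t * ?p 1" by (simp add: p1)
  qed
  moreover have "g (- a) \<le> - ?p1 a"
    using g(2)[rule_format, of "- a"] steepen_minus[OF s1, of a] by simp
  ultimately have ga: "g a = norm a"
    using gp[of a] by (simp add: linear_neg[OF g(1)] hermitian_norm_selfadjoint[OF sa])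
  obtain f where f: "f \<in> states" "\<And>x. Re (blinfun_apply f x) = g x"
    using state_of_functional[OF g(1) gp g1] by blast
  have "f \<notin> open_segment f1 f2" if f12: "f1 \<in> states" "f2 \<in> states" for f1 f2
  proof
    assume "f \<in> open_segment f1 f2"
    then obtain u where u: "f1 \<noteq> f2" "0 < u" "u < 1" "f = (1 - u) *\<^sub>R f1 + u *\<^sub>R f2"
      by (auto simp: in_segment)
    have "(1 - u) * Re (blinfun_apply f1 x) + u * Re (blinfun_apply f2 x) = g x" for x
      by (simp add: f(2)[symmetric] u(4) blinfun.add_left blinfun.scaleR_left)
    then have "(\<lambda>x. Re (blinfun_apply f1 x)) = g \<and> (\<lambda>x. Re (blinfun_apply f2 x)) = g"
      using u(2,3) f12 by (intro extreme[rule_format])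
        (auto intro: linear_Re_blinfun Re_state_le_hermitian_norm)
    then have "Re (blinfun_apply f1 x) = Re (blinfun_apply f2 x)" for x by (metis (no_types))
    then have "f1 = f2" using f12 by (intro state_eqI) auto
    with u show False by simp
  qed
  then have "f \<in> pure_states" using f(1) by (auto simp: pure_states_def extreme_point_of_def)
  moreover have "blinfun_apply f a = of_real (norm a)"
    using state_selfadjoint(1)[OF f(1) sa] f(2)[of a] ga by (simp add: complex_eq_iff complex_is_Real_iff)
  ultimately show thesis by (rule that)
qed

section \<open>Hilbert modules\<close>

context cstar_inner_product
begin

lemma ip_add_left: "ip (x + y) z = ip x z + ip y z"
  by (metis ip_add_right star_add star_ip)

lemma ip_scaleC_left: "ip (c *\<^sub>C x) z = cnj c *\<^sub>C ip x z"
  by (metis ip_scaleC_right star_scaleC star_ip)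

lemma ip_minus_right: "ip x (- y) = - ip x y"
  using ip_scaleC_right[of x "- 1" y] by (simp add: scaleC_minus_left)

lemma ip_minus_left: "ip (- x) y = - ip x y"
  using ip_scaleC_left[of "- 1" x y] by (simp add: scaleC_minus_left)

lemma ip_diff_right: "ip x (y - z) = ip x y - ip x z"
  using ip_add_right[of x y "- z"] by (simp add: ip_minus_right)

lemma ip_diff_left: "ip (x - y) z = ip x z - ip y z"
  using ip_add_left[of x "- y" z] by (simp add: ip_minus_left)

lemma ip_zero_left: "ip 0 y = 0"
  using ip_scaleC_left[of 0 0 y] by simp

lemma ip_scaleR_right: "ip x (r *\<^sub>R y) = r *\<^sub>R ip x y"
  using ip_scaleC_right[of x "complex_of_real r" y] by (simp add: scaleC_of_real)

lemma state_ip_self: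
  assumes "f \<in> states"
  shows "Re (blinfun_apply f (ip x x)) \<ge> 0" "Im (blinfun_apply f (ip x x)) = 0"
  using state_positive[OF assms ip_positive[of x]] by (auto simp: complex_nonneg_Reals_iff)

lemma state_cauchy_schwarz:
  assumes f: "f \<in> states"
  shows "(cmod (blinfun_apply f (ip u v)))\<^sup>2
    \<le> Re (blinfun_apply f (ip u u)) * Re (blinfun_apply f (ip v v))"
proof -
  define \<alpha> where "\<alpha> = blinfun_apply f (ip u v)"
  define U where "U = Re (blinfun_apply f (ip u u))"
  define V where "V = Re (blinfun_apply f (ip v v))"
  have UV: "U \<ge> 0" "V \<ge> 0" "blinfun_apply f (ip u u) = of_real U" "blinfun_apply f (ip v v) = of_real V"
    using state_ip_self[OF f] by (simp_all add: U_def V_def complex_eq_iff)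
  have \<alpha>': "blinfun_apply f (ip v u) = cnj \<alpha>"
    using state_star[OF f, of "ip u v"] by (simp add: star_ip \<alpha>_def)
  have ineq: "0 \<le> U - 2 * s * (cmod \<alpha>)\<^sup>2 + s\<^sup>2 * (cmod \<alpha>)\<^sup>2 * V" for s :: real
  proof -
    \<comment> \<open>The factor \<open>cnj \<alpha>\<close> absorbs the phase, so that positivity
      at w is a real quadratic inequality in s.\<close>
    define w where "w = u - (of_real s * cnj \<alpha>) *\<^sub>C v"
    have "blinfun_apply f (ip w w)
        = of_real U - 2 * of_real s * (\<alpha> * cnj \<alpha>) + (of_real s)\<^sup>2 * (\<alpha> * cnj \<alpha>) * of_real V"
      by (simp add: w_def ip_diff_left ip_diff_right ip_scaleC_left ip_scaleC_right
          blinfun.diff_right blinfun.add_right state_scaleC[OF f] scaleC_simps UV \<alpha>' \<alpha>_def[symmetric] algebra_simps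
          power2_eq_square)
    also have "\<alpha> * cnj \<alpha> = of_real ((cmod \<alpha>)\<^sup>2)"
      by (simp only: complex_norm_square)
    finally have "blinfun_apply f (ip w w)
        = of_real (U - 2 * s * (cmod \<alpha>)\<^sup>2 + s\<^sup>2 * (cmod \<alpha>)\<^sup>2 * V)" by simp
    then show ?thesis using state_ip_self(1)[OF f, of w] by (simp only: Re_complex_of_real)
  qed
  have "(cmod \<alpha>)\<^sup>2 \<le> U * V"
  proof (cases "V = 0")
    case True
    have "\<alpha> = 0"
    proof (rule ccontr)
      assume "\<alpha> \<noteq> 0"
      \<comment> \<open>When V = 0 the inequality is affine in s, and this s makes its right-hand
        side equal to -1. When V > 0 the minimiser s = 1 / V is used below.\<close>
      then show False using ineq[of "(U + 1) / (2 * (cmod \<alpha>)\<^sup>2)"] UV by (simp add: True)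
    qed
    then show ?thesis using True by simp
  next
    case False
    then have V: "V > 0" using UV by simp
    have "U - 2 * (1 / V) * (cmod \<alpha>)\<^sup>2 + (1 / V)\<^sup>2 * (cmod \<alpha>)\<^sup>2 * V = U - (cmod \<alpha>)\<^sup>2 / V"
      using V by (simp add: power2_eq_square)
    then have "(cmod \<alpha>)\<^sup>2 / V \<le> U" using ineq[of "1 / V"] by simp
    then show ?thesis using V by (simp add: field_simps)
  qed
  then show ?thesis by (simp add: \<alpha>_def U_def V_def)
qed

end

context hilbert_cstar_module
begin

lemma norm_ip_self: "norm (ip x x) = (norm x)\<^sup>2"
  by (simp add: norm_ip)

text \<open>The sort of the module relates the norm to real scalars only; complex homogeneity comes
  from the inner product.\<close>

lemma norm_scaleC_module: "norm (c *\<^sub>C (x::'x)) = cmod c * norm x"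
proof -
  have "ip (c *\<^sub>C x) (c *\<^sub>C x) = (cnj c * c) *\<^sub>C ip x x"
    by (simp add: ip_scaleC_left ip_scaleC_right scaleC_scaleC mult.commute)
  then have "(norm (c *\<^sub>C x))\<^sup>2 = (cmod c * norm x)\<^sup>2"
    by (simp only: norm_ip_self[symmetric] norm_scaleC)
      (simp add: norm_ip_self norm_mult power2_eq_square)
  then show ?thesis by simp
qed

lemma submodule_scaleC:
  assumes "submodule act Y" "y \<in> Y"
  shows "c *\<^sub>C y \<in> Y"
proof -
  have "c *\<^sub>C y = act y (c *\<^sub>C 1)" by (simp add: act_scaleC_right act_one)
  then show ?thesis using assms by (simp add: submodule_def)
qed

text \<open>
  The uniform lower bound makes the set of \<open>t\<close> for which \<open>G - \<i>t\<close> is onto stable under steps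
  smaller than \<open>m\<close>; for large \<open>t\<close> surjectivity is automatic.
\<close>

lemma surj_of_lower_bound_on_imaginary_axis:
  assumes cl: "closed Y" and sm: "submodule act Y"
    and GY: "\<And>x. x \<in> Y \<Longrightarrow> G x \<in> Y"
    and Gdiff: "\<And>x y. x \<in> Y \<Longrightarrow> y \<in> Y \<Longrightarrow> G (x - y) = G x - G y"
    and Gbound: "\<And>x. x \<in> Y \<Longrightarrow> norm (G x) \<le> K * norm x"
    and m: "m > 0"
    and lower: "\<And>t x. x \<in> Y \<Longrightarrow> m * norm x \<le> norm (G x - (\<i> * of_real t) *\<^sub>C x)"
    and z: "z \<in> Y"
  shows "\<exists>x\<in>Y. G x = z"
proof -
  define P where "P t \<longleftrightarrow> (\<forall>z\<in>Y. \<exists>x\<in>Y. G x - (\<i> * of_real t) *\<^sub>C x = z)" for t :: real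
  have sub: "subspace Y" using sm by (simp add: submodule_def)
  note closure = subspace_add[OF sub] subspace_diff[OF sub] submodule_scaleC[OF sm] GY
  have complete: "complete Y" using cl by (simp add: complete_eq_closed)
  have ne: "Y \<noteq> {}" using z by blast
  have large: "P T" if T: "T > K" "T > 0" for T
    unfolding P_def
  proof
    fix z assume z: "z \<in> Y"
    \<comment> \<open>This is the inverse of i T. It turns G x - i T x = z into x = c (G x - z), a
      contraction for T > K. The constant uses \<open>max 0 K\<close> because K may be
      negative.\<close>
    define c where "c = Complex 0 (- 1 / T)"
    have c: "cmod c = 1 / T" "\<i> * complex_of_real T * c = 1"
      using T by (simp_all add: c_def norm_mult cmod_def complex_eq_iff)
    have "\<exists>!x\<in>Y. c *\<^sub>C (G x - z) = x"
    proof (rule Banach_fix[OF complete ne, where c="max 0 K / T"])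
      fix x y assume xy: "x \<in> Y" "y \<in> Y"
      have "dist (c *\<^sub>C (G x - z)) (c *\<^sub>C (G y - z)) = norm (c *\<^sub>C G (x - y))"
        by (simp add: dist_norm scaleC_diff_right[symmetric] Gdiff xy)
      also have "\<dots> = norm (G (x - y)) / T"
        by (simp add: norm_scaleC_module c)
      also have "\<dots> \<le> (max 0 K * norm (x - y)) / T"
        using T Gbound[of "x - y"] closure(2)[OF xy]
        by (intro divide_right_mono order.trans[OF Gbound] mult_right_mono) auto
      finally show "dist (c *\<^sub>C (G x - z)) (c *\<^sub>C (G y - z)) \<le> max 0 K / T * dist x y"
        by (simp add: dist_norm)
    qed (use T z in \<open>auto intro!: closure\<close>)
    then obtain x where x: "x \<in> Y" "c *\<^sub>C (G x - z) = x" by blast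
    then have "(\<i> * of_real T) *\<^sub>C x = (\<i> * complex_of_real T * c) *\<^sub>C (G x - z)"
      by (metis scaleC_scaleC)
    then have "G x - (\<i> * of_real T) *\<^sub>C x = z" using c by simp
    with x show "\<exists>x\<in>Y. G x - (\<i> * of_real T) *\<^sub>C x = z" by blast
  qed
  have step: "P s" if Pt: "P t" and st: "\<bar>s - t\<bar> < m" for s t
    unfolding P_def
  proof
    fix z assume z: "z \<in> Y"
    from Pt obtain R where R: "R z \<in> Y" "G (R z) - (\<i> * of_real t) *\<^sub>C R z = z" if "z \<in> Y" for z
      unfolding P_def by metis
    \<comment> \<open>The lower bound makes the solution map at t Lipschitz with constant 1 / m,
      whatever t is.\<close>
    have R_lip: "m * norm (R u - R v) \<le> norm (u - v)" if "u \<in> Y" "v \<in> Y" for u v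
    proof -
      have "u - v = (G (R u) - (\<i> * of_real t) *\<^sub>C R u) - (G (R v) - (\<i> * of_real t) *\<^sub>C R v)"
        using R that by simp
      also have "\<dots> = G (R u - R v) - (\<i> * of_real t) *\<^sub>C (R u - R v)"
        using R(1) that by (simp add: Gdiff scaleC_diff_right)
      finally show ?thesis using lower[of "R u - R v" t] R that closure(2) by simp
    qed
    \<comment> \<open>The equation at s is the one at t with right-hand side z + i (s - t) x, hence
      a fixed point problem for the solution map.\<close>
    let ?d = "\<i> * complex_of_real (s - t)"
    have "\<exists>!x\<in>Y. R (z + ?d *\<^sub>C x) = x"
    proof (rule Banach_fix[OF complete ne, where c="\<bar>s - t\<bar> / m"])
      fix x y assume xy: "x \<in> Y" "y \<in> Y"
      have "m * norm (R (z + ?d *\<^sub>C x) - R (z + ?d *\<^sub>C y)) \<le> norm (?d *\<^sub>C (x - y))"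
        using R_lip[of "z + ?d *\<^sub>C x" "z + ?d *\<^sub>C y"] xy z closure by (simp add: scaleC_diff_right)
      also have "\<dots> = \<bar>s - t\<bar> * norm (x - y)"
        by (simp only: norm_scaleC_module norm_mult norm_of_real) simp
      finally show "dist (R (z + ?d *\<^sub>C x)) (R (z + ?d *\<^sub>C y)) \<le> \<bar>s - t\<bar> / m * dist x y"
        using m by (simp add: dist_norm field_simps)
    qed (use m st z R closure in auto)
    then obtain x where x: "x \<in> Y" "R (z + ?d *\<^sub>C x) = x" by blast
    then have "G x - (\<i> * of_real t) *\<^sub>C x = z + ?d *\<^sub>C x"
      using R(2)[of "z + ?d *\<^sub>C x"] z closure by simp
    then have "G x - (\<i> * of_real s) *\<^sub>C x = z"
      by (simp add: scaleC_simps algebra_simps)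
    with x show "\<exists>x\<in>Y. G x - (\<i> * of_real s) *\<^sub>C x = z" by blast
  qed
  \<comment> \<open>The step length m / 2 is below m, so finitely many steps lead from a large
    parameter to 0.\<close>
  have descend: "P (real n * (m / 2)) \<Longrightarrow> P 0" for n
  proof (induction n)
    case (Suc n)
    have "P (real n * (m / 2))"
      by (rule step[OF Suc.prems]) (use m in \<open>simp add: algebra_simps\<close>)
    then show ?case by (rule Suc.IH)
  qed simp
  obtain n where n: "max 0 K < real n * (m / 2)"
    using reals_Archimedean3[of "m / 2"] m by auto
  have "P 0" by (rule descend[of n]) (use n in \<open>intro large; simp\<close>)
  then show ?thesis using z by (simp add: P_def)
qed

end

section \<open>Complementation with respect to the second inner product\<close>

theorem corollary4p9:
  fixes act :: "'x::{banach, complex_vector} \<Rightarrow> 'a::cstar_algebra \<Rightarrow> 'x"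
    and ip B :: "'x \<Rightarrow> 'x \<Rightarrow> 'a"
    and Y :: "'x set"
    and c k :: real
  assumes "wstar_algebra TYPE('a)"
    and "hilbert_cstar_module act ip"
    and "self_dual act ip"
    and "closed Y" and "orthogonally_complemented act ip Y"
    and "cstar_inner_product act B" and "bounded_form B"
    and "c > 0" and "k > 0"
    and "\<forall>f\<in>pure_states. \<forall>x\<in>Y. \<exists>y\<in>Y. norm y = 1 \<and>
           Re (blinfun_apply f (ip y y)) \<ge> k \<and>
           (cmod (blinfun_apply f (B x y)))\<^sup>2 \<ge>
             c * Re (blinfun_apply f (ip x x)) * Re (blinfun_apply f (ip y y))"
  shows "orthogonally_complemented act B Y"
proof -
  interpret X: hilbert_cstar_module act ip by fact
  interpret B: cstar_inner_product act B by fact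
  have sm: "submodule act Y" and decomp: "\<exists>y\<in>Y. \<exists>s\<in>orthogonal_complement ip Y. x = y + s" for x
    using assms(5) unfolding orthogonally_complemented_def by auto
  have sub: "subspace Y" using sm by (simp add: submodule_def)
  obtain M where M: "norm (B x y) \<le> M * norm x * norm y" for x y
    using assms(7) unfolding bounded_form_def by blast
  have "\<exists>g\<in>Y. \<forall>y\<in>Y. ip g y = B x y" for x
  proof -
    have "bounded_linear (B x)"
      by (rule bounded_linear_intro[where K="M * norm x"])
        (simp_all add: B.ip_add_right B.ip_scaleR_right M mult.commute[of "norm _"])
    then obtain x' where x': "\<forall>y. B x y = ip x' y"
      using assms(3) B.ip_act_right unfolding self_dual_def by blast
    obtain g s where gs: "g \<in> Y" "s \<in> orthogonal_complement ip Y" "x' = g + s"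
      using decomp by blast
    then have "ip g y = B x y" if "y \<in> Y" for y
      using that x' by (simp add: orthogonal_complement_def X.ip_add_left)
    with gs show ?thesis by blast
  qed
  then obtain G where GY: "G x \<in> Y" and G: "y \<in> Y \<Longrightarrow> ip (G x) y = B x y" for x y by metis
  have unique: "g = h" if gh: "g \<in> Y" "h \<in> Y" "\<And>y. y \<in> Y \<Longrightarrow> ip g y = ip h y" for g h
  proof -
    have "ip (g - h) (g - h) = 0"
      using gh(3)[OF subspace_diff[OF sub gh(1,2)]] by (simp add: X.ip_diff_left)
    then show ?thesis using X.ip_definite by fastforce
  qed
  have Gdiff: "G (x - y) = G x - G y" for x y
    by (rule unique) (simp_all add: GY G subspace_diff[OF sub] X.ip_diff_left B.ip_diff_left)
  have G_bound: "norm (G x) \<le> \<bar>M\<bar> * norm x" for x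
  proof (cases "G x = 0")
    case False
    have "norm (G x) * norm (G x) \<le> M * norm x * norm (G x)"
      using M[of x "G x"] X.norm_ip_self[of "G x"] G[OF GY, of x x]
      by (simp add: power2_eq_square)
    with False have "norm (G x) \<le> M * norm x" by simp
    also have "\<dots> \<le> \<bar>M\<bar> * norm x" by (intro mult_right_mono) auto
    finally show ?thesis .
  qed simp
  \<comment> \<open>At x = 0 the bound is trivial; a norm-attaining pure state needs
    \<open>ip x x\<close> to be nonzero.\<close>
  have lower: "sqrt c * norm x \<le> norm (G x - (\<i> * of_real t) *\<^sub>C x)" if x: "x \<in> Y" for x t
  proof (cases "x = 0")
    case False
    then have "ip x x \<noteq> 0" using X.ip_definite by blast
    then obtain f where f: "f \<in> pure_states" "blinfun_apply f (ip x x) = of_real (norm (ip x x))"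
      using pure_state_attaining_norm[OF X.ip_positive] by blast
    then have fs: "f \<in> states" by (simp add: pure_states_def extreme_point_of_def)
    define F where "F u = Re (blinfun_apply f (ip u u))" for u
    obtain y where y: "y \<in> Y" "F y \<ge> k" "(cmod (blinfun_apply f (ip (G x) y)))\<^sup>2 \<ge> c * F x * F y"
      using assms(10) f(1) x G unfolding F_def by metis
    then have "c * F x * F y \<le> F (G x) * F y"
      using X.state_cauchy_schwarz[OF fs, of "G x" y] unfolding F_def by linarith
    \<comment> \<open>The lower bound k makes \<open>F y\<close> positive, so it can be
      cancelled.\<close>
    then have cF: "c * F x \<le> F (G x)" using y(2) \<open>k > 0\<close> by simp
    define w where "w = G x - (\<i> * of_real t) *\<^sub>C x"
    \<comment> \<open>Symmetry of \<open>B\<close> makes the cross terms in \<open>ip w w\<close>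
      cancel below.\<close>
    have sa: "ip (G x) x = ip x (G x)"
      using G[OF x, of x] X.star_ip[of "G x" x] B.star_ip[of x x] by simp
    have it2: "\<i> * complex_of_real t * (\<i> * complex_of_real t) = - of_real (t\<^sup>2)"
      by (simp add: complex_eq_iff power2_eq_square)
    have "ip w w = ip (G x) (G x) + t\<^sup>2 *\<^sub>R ip x x"
      by (simp add: w_def X.ip_diff_left X.ip_diff_right X.ip_scaleC_left X.ip_scaleC_right sa
          scaleC_simps it2 scaleC_of_real del: of_real_power)
    then have "F w = F (G x) + t\<^sup>2 * F x"
      by (simp add: F_def blinfun.add_right blinfun.scaleR_right)
    then have "F (G x) \<le> F w" using X.state_ip_self(1)[OF fs, of x] by (simp add: F_def)
    moreover have "F w \<le> (norm w)\<^sup>2"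
      using state_selfadjoint(2)[OF fs X.star_ip[of w w]] by (simp add: F_def X.norm_ip_self)
    moreover have "F x = (norm x)\<^sup>2" using f(2) by (simp add: F_def X.norm_ip_self)
    ultimately have "(sqrt c * norm x)\<^sup>2 \<le> (norm w)\<^sup>2"
      using cF \<open>c > 0\<close> by (simp add: power_mult_distrib)
    then show ?thesis unfolding w_def by (rule power2_le_imp_le) simp
  qed simp
  have "\<exists>y\<in>Y. \<exists>s\<in>orthogonal_complement B Y. x = y + s" for x
  proof -
    \<comment> \<open>Surjectivity on \<open>Y\<close> is applied to the target \<open>G x\<close>,
      which lies in \<open>Y\<close> although x need not.\<close>
    obtain y where y: "y \<in> Y" "G y = G x"
      using X.surj_of_lower_bound_on_imaginary_axis[OF \<open>closed Y\<close> sm GY Gdiff G_bound _ lower GY]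
        \<open>c > 0\<close> by (metis real_sqrt_gt_zero)
    have "B (x - y) z = 0" if "z \<in> Y" for z
      using G[OF that, of x] G[OF that, of y] y by (simp add: B.ip_diff_left)
    then show ?thesis using y(1)
      by (intro bexI[of _ y] bexI[of _ "x - y"]) (auto simp: orthogonal_complement_def)
  qed
  moreover have "Y \<inter> orthogonal_complement B Y = {0}"
    using B.ip_definite subspace_0[OF sub] by (auto simp: orthogonal_complement_def B.ip_zero_left)
  ultimately show ?thesis using sm unfolding orthogonally_complemented_def by blast
qed

end
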